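(* Let $\mathbf{a}$ and $\mathbf{b}$ be two admissible compositions such that $\zeta(\mathbf{a})_{n,n}=\zeta(\mathbf{b})_{n,n}$ for all integers $n\geqslant0$. Then $\mathbf{b}=\mathbf{a}$ or $\mathbf{b}=\overline{\mathbf{a}}$.
   Context: A composition is a finite sequence $\mathbf{a}=(a_1,\ldots,a_r)$ of positive integers ($r\geqslant0$); it is admissible if $r=0$ or $a_1\geqslant2$. Its binary word is $\mathbf{w}(\mathbf{a})=0^{a_1-1}1\cdots0^{a_r-1}1$ ($0^u$ = $u$ zeros). The dual of a word $\varepsilon_1\cdots\varepsilon_k$ is $\overline{\varepsilon_k}\cdots\overline{\varepsilon_1}$ with $\overline0=1,\overline1=0$; for admissible $\mathbf{a}$, $\overline{\mathbf{a}}$ is the admissible composition whose word is the dual of $\mathbf{w}(\mathbf{a})$. For non-empty admissible $\mathbf{a}$ and $n\geqslant 0$, $\zeta(\mathbf{a})_{n,n}=\sum_{n_1>\cdots>n_r>n}\binom{n_1+n}{n}^{-1}n_1^{-a_1}\cdots n_r^{-a_r}$, and $\zeta(\varnothing)_{n,n}=\binom{2n}{n}^{-1}$. *)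

theory Defs
  imports "HOL-Analysis.Analysis"
begin

definition composition :: "nat list \<Rightarrow> bool" where
  "composition a \<longleftrightarrow> (\<forall>k \<in> set a. 0 < k)"

definition admissible :: "nat list \<Rightarrow> bool" where
  "admissible a \<longleftrightarrow> composition a \<and> (a = [] \<or> 2 \<le> hd a)"

text \<open>Binary words are boolean lists: the letter 0 is \<^const>\<open>False\<close>, the letter 1 is \<^const>\<open>True\<close>.\<close>

definition word :: "nat list \<Rightarrow> bool list" where
  "word a = concat (map (\<lambda>k. replicate (k - 1) False @ [True]) a)"

definition dual_word :: "bool list \<Rightarrow> bool list" where
  "dual_word w = rev (map Not w)"

definition dual :: "nat list \<Rightarrow> nat list" where
  "dual a = (THE b. admissible b \<and> word b = dual_word (word a))"

text \<open>The condition \<open>sorted_wrt (>) (ns @ [n])\<close> says \<open>n\<^sub>1 > \<dots> > n\<^sub>r > n\<close>. For admissible \<open>a\<close> the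
  series has nonnegative terms and converges, so its value does not depend on the order of summation.\<close>

definition zeta_nn :: "nat list \<Rightarrow> nat \<Rightarrow> real" where
  "zeta_nn a n =
    (if a = [] then 1 / real ((2 * n) choose n)
     else (\<Sum>\<^sub>\<infinity>ns \<in> {ns. length ns = length a \<and> sorted_wrt (>) (ns @ [n])}.
             1 / real ((hd ns + n) choose n) * (\<Prod>i<length a. 1 / real (ns ! i) ^ (a ! i))))"

text \<open>Well-definedness of \<^const>\<open>dual\<close>.\<close>

lemma word_Nil [simp]: "word [] = []"
  by (simp add: word_def)

lemma word_Cons: "word (k # a) = replicate (k - 1) False @ True # word a"
  by (simp add: word_def)

lemma word_eq_Nil_iff [simp]: "word a = [] \<longleftrightarrow> a = []"
  by (cases a) (auto simp: word_Cons)

lemma last_word: "a \<noteq> [] \<Longrightarrow> last (word a)"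
proof (induction a)
  case (Cons k a)
  then show ?case by (cases "a = []") (auto simp: word_Cons)
qed simp

lemma hd_word: "a \<noteq> [] \<Longrightarrow> hd (word a) \<longleftrightarrow> hd a \<le> 1"
  by (cases a; cases "hd a - 1") (auto simp: word_Cons)

lemma replicate_False_True_inj:
  "replicate i False @ True # u = replicate j False @ True # v \<Longrightarrow> i = j \<and> u = v"
proof (induction i arbitrary: j)
  case 0
  then show ?case by (cases j) auto
next
  case (Suc i)
  then show ?case by (cases j) auto
qed

lemma word_inj: "composition a \<Longrightarrow> composition b \<Longrightarrow> word a = word b \<Longrightarrow> a = b"
proof (induction a arbitrary: b)
  case Nil
  then show ?case by (metis word_Nil word_eq_Nil_iff)
next
  case (Cons k a)
  then obtain l b' where b: "b = l # b'" by (cases b) (auto simp: word_Cons)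
  have "k - 1 = l - 1 \<and> word a = word b'"
    using Cons.prems(3) by (intro replicate_False_True_inj) (simp add: b word_Cons)
  moreover have "0 < k" "0 < l" "composition a" "composition b'"
    using Cons.prems by (auto simp: b composition_def)
  ultimately show ?case using Cons.IH[of b'] b by auto
qed

lemma word_surj: "w = [] \<or> last w \<Longrightarrow> \<exists>a. composition a \<and> word a = w"
proof (induction w)
  case Nil
  then show ?case by (intro exI[of _ "[]"]) (simp add: composition_def)
next
  case (Cons x w)
  have "w = [] \<or> last w" using Cons.prems by (auto split: if_splits)
  then obtain a where a: "composition a" "word a = w" using Cons.IH by blast
  show ?case
  proof (cases x)
    case True
    then show ?thesis
      using a by (intro exI[of _ "1 # a"]) (auto simp: composition_def word_Cons)
  next
    case False
    then have "a \<noteq> []" using Cons.prems a by auto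
    then obtain k a' where k: "a = k # a'" by (cases a) auto
    then obtain j where "k = Suc j" using a(1) by (cases k) (auto simp: composition_def)
    then show ?thesis
      using a k False by (intro exI[of _ "Suc k # a'"]) (auto simp: composition_def word_Cons)
  qed
qed

lemma dual_ex1:
  assumes "admissible a"
  shows "\<exists>!b. admissible b \<and> word b = dual_word (word a)"
proof -
  have "dual_word (word a) = [] \<or> last (dual_word (word a))"
  proof (cases "a = []")
    case False
    then show ?thesis using assms hd_word[of a]
      by (simp add: dual_word_def admissible_def last_rev hd_map)
  qed (simp add: dual_word_def)
  then obtain b where b: "composition b" "word b = dual_word (word a)"
    using word_surj by blast
  have "2 \<le> hd b" if "b \<noteq> []"
  proof -
    have "a \<noteq> []" using that b(2) by (auto simp: dual_word_def)
    then have "\<not> hd (word b)"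
      using last_word[of a] by (simp add: b(2) dual_word_def hd_rev last_map)
    then show ?thesis using hd_word[OF that] by simp
  qed
  then show ?thesis using b word_inj by (metis admissible_def)
qed

lemma
  assumes "admissible a"
  shows admissible_dual: "admissible (dual a)"
    and word_dual: "word (dual a) = dual_word (word a)"
  using theI'[OF dual_ex1[OF assms]] by (simp_all add: dual_def)

end

theory Submission
  imports Defs "HOL-Computational_Algebra.Polynomial"
begin

text \<open>
  Write \<open>f\<^sub>w(n)\<close> for \<open>\<zeta>(a)\<^sub>n\<^sub>,\<^sub>n\<close>, where \<open>w\<close> is the word of \<open>a\<close>. The difference \<open>f\<^sub>w(n-1) - f\<^sub>w(n)\<close> is the sum
  of three terms \<open>n\<^sup>-\<^sup>j f\<^sub>v(n)\<close>: \<open>v\<close> arises from \<open>w\<close> by removing the maximal block \<open>01\<^sup>p\<close> on the left, or the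
  maximal block \<open>0\<^sup>q1\<close> on the right, or both, and \<open>j\<close> is the number of letters removed. Iterating this,
  \<open>f\<^sub>w\<close> becomes a combination with coefficients in \<open>\<nat>\<close> of nested sums
  \<open>T\<^sub>J(n) = \<Sum>\<^bsub>n < n\<^sub>1 < \<dots> < n\<^sub>r\<^esub> n\<^sub>1\<^sup>-\<^sup>j\<^sup>1 \<cdots> n\<^sub>r\<^sup>-\<^sup>j\<^sup>r / (2n\<^sub>r choose n\<^sub>r)\<close>. These are linearly independent over
  \<open>\<real>(n)\<close> by a pole argument, so \<open>f\<^sub>w\<close> determines the coefficients.

  The coefficients determine \<open>w\<close> up to duality, by induction on its length: the largest possible first
  index of \<open>J\<close> belongs to the removal on both sides and yields the inner word up to duality; the
  others yield the two block lengths up to order. The only way to combine them to something other than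
  \<open>w\<close> and its dual makes an inner word intertwine \<open>01\<^sup>p\<close> with \<open>0\<^sup>p1\<close>, so that counting zeros gives
  \<open>p = 1\<close> for both blocks; but for blocks of equal length duality exchanges the two ends.
\<close>

section \<open>Double tails\<close>

definition descents :: "nat \<Rightarrow> nat \<Rightarrow> nat list set" where
  "descents r n = {ns. length ns = r \<and> sorted_wrt (>) (ns @ [n])}"

definition monomial :: "nat list \<Rightarrow> nat list \<Rightarrow> real" where
  "monomial a ns = (\<Prod>(k, x) \<leftarrow> zip a ns. 1 / real x ^ k)"

text \<open>Two parameters allow \<open>m\<close> and \<open>n\<close> to be raised separately.
  Appending \<open>n\<close> makes it the default top index of the empty chain, which matches the
  value of the zeta series at the empty composition.\<close>

definition tail_term :: "nat list \<Rightarrow> nat \<Rightarrow> nat \<Rightarrow> nat list \<Rightarrow> real" where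
  "tail_term a m n ns = monomial a ns / real ((hd (ns @ [n]) + m) choose m)"

text \<open>The double tail \<open>\<zeta>(a)\<^sub>m\<^sub>,\<^sub>n\<close>.\<close>

definition tail :: "nat list \<Rightarrow> nat \<Rightarrow> nat \<Rightarrow> real" where
  "tail a m n = (\<Sum>\<^sub>\<infinity>ns \<in> descents (length a) n. tail_term a m n ns)"

section \<open>Monomials and decreasing chains of indices\<close>

lemma monomial_Nil [simp]: "monomial [] ns = 1"
  by (simp add: monomial_def)

lemma monomial_Cons [simp]: "monomial (k # a) (x # ns) = monomial a ns / real x ^ k"
  by (simp add: monomial_def)

lemma monomial_snoc:
  "length a = length ns \<Longrightarrow> monomial (a @ [k]) (ns @ [x]) = monomial a ns / real x ^ k"
  by (simp add: monomial_def)

lemma monomial_nonneg [simp]: "0 \<le> monomial a ns"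
  unfolding monomial_def by (rule prod_list_nonneg) auto

lemma monomial_eq_prod:
  "length ns = length a \<Longrightarrow> monomial a ns = (\<Prod>i<length a. 1 / real (ns ! i) ^ (a ! i))"
proof (induction a arbitrary: ns)
  case (Cons k a)
  then obtain x ns' where "ns = x # ns'" by (cases ns) auto
  with Cons show ?case by (simp add: prod.lessThan_Suc_shift del: prod.lessThan_Suc)
qed simp

lemma descents_0 [simp]: "descents 0 n = {[]}"
  by (auto simp: descents_def)

lemma descents_Suc:
  "descents (Suc r) n = (\<lambda>(ns, x). x # ns) ` (SIGMA ns:descents r n. {hd (ns @ [n])<..})"
    (is "?L = ?R")
proof (rule set_eqI)
  fix ns
  have "x # ms \<in> ?L \<longleftrightarrow> ms \<in> descents r n \<and> x > hd (ms @ [n])" for x ms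
    by (cases ms) (auto simp: descents_def)
  moreover have "[] \<notin> ?L" by (simp add: descents_def)
  ultimately show "ns \<in> ?L \<longleftrightarrow> ns \<in> ?R"
    by (cases ns) (auto simp: image_iff)
qed

lemma descents_Suc_snoc:
  "descents (Suc r) n = descents (Suc r) (Suc n) \<union> (\<lambda>ns. ns @ [Suc n]) ` descents r (Suc n)"
    (is "?L = ?R")
proof (rule set_eqI)
  fix ns
  show "ns \<in> ?L \<longleftrightarrow> ns \<in> ?R"
  proof (cases ns rule: rev_cases)
    case (snoc ms x)
    show ?thesis
      by (auto simp: snoc descents_def sorted_wrt_append image_iff)
  qed (auto simp: descents_def)
qed

lemma descents_snoc_disjoint:
  "descents (Suc r) (Suc n) \<inter> (\<lambda>ns. ns @ [Suc n]) ` descents r (Suc n) = {}"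
  by (auto simp: descents_def sorted_wrt_append)

lemma zeta_nn_eq_tail: "zeta_nn a n = tail a n n"
proof (cases "a = []")
  case True
  then show ?thesis by (simp add: zeta_nn_def tail_def tail_term_def mult_2)
next
  case False
  show ?thesis
    unfolding zeta_nn_def tail_def descents_def using False
    by (auto intro!: infsum_cong simp: tail_term_def monomial_eq_prod hd_append)
qed

lemma tail_Nil [simp]: "tail [] m n = 1 / real ((n + m) choose m)"
  by (simp add: tail_def tail_term_def)

section \<open>Convergence of double tails and their recurrences in \<open>m\<close> and
  \<open>n\<close>\<close>

lemma tail_term_nonneg [simp]: "0 \<le> tail_term a m n ns"
  by (simp add: tail_term_def)

lemma tail_nonneg: "0 \<le> tail a m n"
  unfolding tail_def by (rule infsum_nonneg) simp

text \<open>The terms telescope: they are differences of consecutive values of \<open>h\<close>,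
  which tends to 0 because \<open>m\<close> is positive.\<close>

lemma has_sum_reciprocal_binomial:
  assumes "m > 0"
  shows "((\<lambda>k. 1 / (real k * real ((k + m) choose m))) has_sum
          1 / (real m * real ((N + m) choose m))) {N<..}"
proof -
  define h where "h k = 1 / (real m * real ((k + m) choose m))" for k
  have h_diff: "h k - h (Suc k) = 1 / (real (Suc k) * real ((Suc k + m) choose m))" for k
  proof -
    have "Suc k * ((Suc k + m) choose m) = (Suc k + m) * ((k + m) choose m)"
      using binomial_absorb_comp[of "Suc k + m" m] by simp
    then have "real (Suc k) * real ((Suc k + m) choose m) = (real (Suc k) + real m) * real ((k + m) choose m)"
      by (metis of_nat_add of_nat_mult)
    moreover have "real ((Suc k + m) choose m) > 0" "real ((k + m) choose m) > 0" by simp_all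
    ultimately show ?thesis
      using assms unfolding h_def by (simp add: divide_simps) (simp add: algebra_simps)
  qed
  have "h \<longlonglongrightarrow> 0"
  proof (rule tendsto_sandwich[of "\<lambda>_. 0" _ _ "\<lambda>k. 1 / real (Suc k)"])
    have "h k \<le> 1 / real (Suc k)" for k
    proof -
      have "Suc k \<le> (k + m) choose m"
      proof -
        have "Suc k = Suc k choose k" by (metis binomial_Suc_n)
        also have "\<dots> \<le> (k + m) choose k"
          using assms by (intro binomial_right_mono) simp
        also have "\<dots> = (k + m) choose m"
          using binomial_symmetric[of m "k + m"] by simp
        finally show ?thesis .
      qed
      then have "real (Suc k) * 1 \<le> real ((k + m) choose m) * real m"
        using assms by (intro mult_mono) (auto simp del: of_nat_Suc)
      then show ?thesis unfolding h_def by (simp add: divide_simps mult.commute)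
    qed
    then show "\<forall>\<^sub>F k in sequentially. h k \<le> 1 / real (Suc k)" by simp
    show "(\<lambda>k. 1 / real (Suc k)) \<longlonglongrightarrow> 0" using LIMSEQ_inverse_real_of_nat by (simp add: divide_inverse)
  qed (auto simp: h_def)
  then have "(\<lambda>i. h (i + N)) \<longlonglongrightarrow> 0" by (rule LIMSEQ_ignore_initial_segment)
  then have "(\<lambda>i. h (i + N) - h (Suc i + N)) sums (h (0 + N) - 0)" by (rule telescope_sums')
  then have "((\<lambda>i. 1 / (real (Suc i + N) * real ((Suc i + N + m) choose m))) has_sum h N) UNIV"
    by (intro sums_nonneg_imp_has_sum) (simp_all add: h_diff)
  moreover have "bij_betw (\<lambda>i. Suc i + N) UNIV {N<..}"
    by (rule bij_betw_byWitness[of _ "\<lambda>k. k - Suc N"]) auto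
  ultimately show ?thesis
    unfolding h_def using has_sum_reindex_bij_betw[of "\<lambda>i. Suc i + N" UNIV "{N<..}"
        "\<lambda>k. 1 / (real k * real ((k + m) choose m))"] by simp
qed

text \<open>Summing over the largest index first telescopes, and the inner value is a term of the
  shorter series divided by \<open>m\<close>.\<close>

lemma has_sum_tail_term_1_Cons:
  assumes "m > 0" "(tail_term a m n has_sum s) (descents r n)"
  shows "(tail_term (1 # a) m n has_sum s / real m) (descents (Suc r) n)"
proof -
  define f where "f = tail_term (1 # a) m n \<circ> (\<lambda>(ns, x). x # ns)"
  have f: "((\<lambda>x. f (ns, x)) has_sum tail_term a m n ns / real m) {hd (ns @ [n])<..}" for ns
    using has_sum_cmult_right[OF has_sum_reciprocal_binomial[OF assms(1), of "hd (ns @ [n])"],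
        of "monomial a ns"]
    by (simp add: f_def tail_term_def mult.commute)
  have g: "((\<lambda>ns. tail_term a m n ns / real m) has_sum s / real m) (descents r n)"
    using has_sum_cmult_right[OF assms(2), of "1 / real m"] by simp
  have "f summable_on (SIGMA ns:descents r n. {hd (ns @ [n])<..})"
    using f has_sum_imp_summable[OF g] by (rule summable_on_SigmaI) (auto simp: f_def)
  with f g have "(f has_sum s / real m) (SIGMA ns:descents r n. {hd (ns @ [n])<..})"
    by (rule has_sum_SigmaI)
  then show ?thesis
    unfolding descents_Suc f_def by (subst has_sum_reindex) (auto simp: inj_on_def)
qed

lemma tail_term_Cons_antimono:
  assumes "ns \<in> descents (Suc r) n" "j \<le> k"
  shows "tail_term (k # a) m n ns \<le> tail_term (j # a) m n ns"
proof -
  obtain x ms where ns: "ns = x # ms" "x > 0"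
    using assms(1) by (cases ns) (auto simp: descents_def)
  have "real x ^ j \<le> real x ^ k"
    using ns(2) assms(2) by (intro power_increasing) auto
  then have "monomial a ms / real x ^ k \<le> monomial a ms / real x ^ j"
    using ns(2) by (intro divide_left_mono) auto
  then have "monomial a ms / real x ^ k / real ((x + m) choose m)
      \<le> monomial a ms / real x ^ j / real ((x + m) choose m)"
    by (rule divide_right_mono) simp
  then show ?thesis by (simp add: ns tail_term_def)
qed

text \<open>For positive \<open>m\<close> the binomial forces convergence even when the first
  exponent is 1. Larger first exponents are dominated by that case, which reduces to a shorter
  composition.\<close>

lemma tail_term_summable:
  assumes "m > 0" "composition a"
  shows "tail_term a m n summable_on descents (length a) n"
  using assms(2)
proof (induction a)
  case (Cons k a)
  then have "tail_term (1 # a) m n summable_on descents (Suc (length a)) n"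
    using has_sum_tail_term_1_Cons[OF assms(1)] unfolding summable_on_def composition_def
    by (meson list.set_intros(2))
  then have "tail_term (k # a) m n summable_on descents (Suc (length a)) n"
    by (rule summable_on_comparison_test)
      (use Cons.prems in \<open>auto simp: composition_def Suc_le_eq intro!: tail_term_Cons_antimono\<close>)
  then show ?case by simp
qed simp

lemma tail_has_sum:
  "m > 0 \<Longrightarrow> composition a \<Longrightarrow> (tail_term a m n has_sum tail a m n) (descents (length a) n)"
  unfolding tail_def by (intro has_sum_infsum tail_term_summable)

lemma tail_1_Cons: "m > 0 \<Longrightarrow> composition a \<Longrightarrow> tail (1 # a) m n = tail a m n / real m"
  unfolding tail_def[of "1 # a"]
  using infsumI[OF has_sum_tail_term_1_Cons[OF _ tail_has_sum]] by simp

text \<open>Lowering each first exponent to 1 in turn and summing it out costs a factor 1/m, which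
  is at most 1. The bound later shows that the double tails tend to 0.\<close>

lemma tail_le:
  assumes "m > 0" "composition a"
  shows "tail a m n \<le> 1 / real ((n + m) choose m)"
  using assms(2)
proof (induction a)
  case (Cons k a)
  then have c: "composition a" "composition (1 # a)" "k \<ge> 1" by (auto simp: composition_def)
  have "tail (k # a) m n \<le> tail (1 # a) m n"
    unfolding tail_def
    using tail_term_summable[OF assms(1) Cons.prems] tail_term_summable[OF assms(1) c(2)] c(3)
    by (auto intro!: infsum_mono tail_term_Cons_antimono)
  also have "\<dots> = tail a m n / real m" using tail_1_Cons assms c by simp
  also have "\<dots> \<le> tail a m n / 1"
    using assms(1) tail_nonneg by (intro divide_left_mono) auto
  finally show ?case using Cons.IH c(1) by simp
qed simp

text \<open>Termwise, 1/binom(x+m, m) equals (1 + x/(m+1))/binom(x+m+1, m+1) for the largest index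
  x; the factor x lowers the first exponent by one.\<close>

lemma tail_Suc_left:
  assumes "m > 0" "k \<ge> 2" "composition a"
  shows "tail (k # a) m n = tail (k # a) (Suc m) n + tail ((k - 1) # a) (Suc m) n / real (Suc m)"
proof -
  have c: "composition (k # a)" "composition ((k - 1) # a)"
    using assms by (auto simp: composition_def)
  have "tail_term (k # a) m n ns
      = tail_term (k # a) (Suc m) n ns + tail_term ((k - 1) # a) (Suc m) n ns * (1 / real (Suc m))"
    if ns_in: "ns \<in> descents (Suc (length a)) n" for ns
  proof -
    obtain x ms where ns: "ns = x # ms" "x > 0"
      using ns_in by (cases ns) (auto simp: descents_def)
    have "Suc m * ((x + Suc m) choose Suc m) = (x + Suc m) * ((x + m) choose m)"
      using Suc_times_binomial_eq[of "x + m" m] by (simp add: mult.commute)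
    then have e: "real (Suc m) * real ((x + Suc m) choose Suc m) = (real x + real (Suc m)) * real ((x + m) choose m)"
      by (metis of_nat_add of_nat_mult)
    have p: "real ((x + Suc m) choose Suc m) > 0" "real ((x + m) choose m) > 0"
      by (simp_all del: binomial_Suc_Suc)
    have b: "1 / real ((x + m) choose m) = (1 + real x / real (Suc m)) / real ((x + Suc m) choose Suc m)"
      using e p by (simp add: divide_simps del: binomial_Suc_Suc of_nat_Suc)
    have "real x ^ k = real x * real x ^ (k - 1)"
      using assms(2) power_Suc[of "real x" "k - 1"] by simp
    then have v: "monomial a ms / real x ^ (k - 1) = monomial a ms / real x ^ k * real x"
      using ns(2) by simp
    have "monomial a ms / real x ^ k / real ((x + m) choose m)
        = monomial a ms / real x ^ k * (1 / real ((x + m) choose m))" by simp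
    also have "\<dots> = monomial a ms / real x ^ k / real ((x + Suc m) choose Suc m)
        + monomial a ms / real x ^ k * real x / real ((x + Suc m) choose Suc m) * (1 / real (Suc m))"
      unfolding b by (simp add: ring_distribs add_divide_distrib del: binomial_Suc_Suc of_nat_Suc)
    finally show ?thesis
      by (simp only: ns(1) tail_term_def v monomial_Cons append_Cons list.sel)
  qed
  then have "tail (k # a) m n = (\<Sum>\<^sub>\<infinity>ns\<in>descents (Suc (length a)) n. tail_term (k # a) (Suc m) n ns
      + tail_term ((k - 1) # a) (Suc m) n ns * (1 / real (Suc m)))"
    unfolding tail_def by (auto intro!: infsum_cong)
  also have "\<dots> = tail (k # a) (Suc m) n + tail ((k - 1) # a) (Suc m) n * (1 / real (Suc m))"
    using tail_has_sum[OF _ c(1), of "Suc m" n] tail_has_sum[OF _ c(2), of "Suc m" n]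
    by (intro infsumI has_sum_add has_sum_cmult_left) simp_all
  finally show ?thesis by simp
qed

text \<open>The chains above \<open>n\<close> are split according to whether their smallest entry is
  \<open>Suc n\<close>.\<close>

lemma tail_Suc_right:
  assumes "m > 0" "composition a" "a \<noteq> []"
  shows "tail a m n = tail a m (Suc n) + tail (butlast a) m (Suc n) / real (Suc n) ^ last a"
proof -
  obtain b k where a: "a = b @ [k]" using assms(3) by (cases a rule: rev_cases) auto
  define D where "D = descents (length b) (Suc n)"
  have c: "composition b" using assms(2) by (auto simp: a composition_def)
  have "(tail_term a m n has_sum tail a m (Suc n)) (descents (Suc (length b)) (Suc n))"
  proof -
    have "(tail_term a m (Suc n) has_sum tail a m (Suc n)) (descents (Suc (length b)) (Suc n))"
      using tail_has_sum[OF assms(1,2), of "Suc n"] by (simp add: a)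
    moreover have "tail_term a m n ns = tail_term a m (Suc n) ns"
      if "ns \<in> descents (Suc (length b)) (Suc n)" for ns
      using that by (cases ns) (auto simp: tail_term_def descents_def)
    ultimately show ?thesis by (simp cong: has_sum_cong)
  qed
  moreover have "(tail_term a m n has_sum tail b m (Suc n) / real (Suc n) ^ k) ((\<lambda>ns. ns @ [Suc n]) ` D)"
  proof -
    \<comment> \<open>For empty \<open>ns\<close> the top index of the long chain is
      \<open>Suc n\<close>, which is exactly the default in the term on the right.\<close>
    have "tail_term a m n (ns @ [Suc n]) = tail_term b m (Suc n) ns * (1 / real (Suc n) ^ k)"
      if "ns \<in> D" for ns
      using that by (cases ns) (auto simp: tail_term_def D_def descents_def a monomial_snoc
          simp del: append_Cons simp flip: append_Cons)
    moreover have "((\<lambda>ns. tail_term b m (Suc n) ns * (1 / real (Suc n) ^ k)) has_sum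
        tail b m (Suc n) * (1 / real (Suc n) ^ k)) D"
      unfolding D_def by (intro has_sum_cmult_left tail_has_sum assms c)
    ultimately have "((\<lambda>ns. tail_term a m n (ns @ [Suc n])) has_sum
        tail b m (Suc n) * (1 / real (Suc n) ^ k)) D"
      by (subst has_sum_cong)
    then show ?thesis
      by (subst has_sum_reindex) (auto simp: inj_on_def o_def)
  qed
  ultimately have "(tail_term a m n has_sum tail a m (Suc n) + tail b m (Suc n) / real (Suc n) ^ k)
      (descents (Suc (length b)) n)"
    unfolding descents_Suc_snoc[of _ n] D_def
    by (rule has_sum_Un_disjoint) (rule descents_snoc_disjoint)
  then have "(\<Sum>\<^sub>\<infinity>ns\<in>descents (length a) n. tail_term a m n ns)
      = tail a m (Suc n) + tail b m (Suc n) / real (Suc n) ^ k"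
    by (intro infsumI) (simp add: a)
  then show ?thesis by (subst tail_def) (simp add: a)
qed

section \<open>Words and coefficients\<close>

text \<open>In terms of words, \<open>left\<close> removes a prefix \<open>01\<^sup>p\<close> with \<open>p\<close> maximal, of length \<open>left_weight\<close>;
  dually, \<^const>\<open>butlast\<close> removes a suffix \<open>0\<^sup>q1\<close> with \<open>q\<close> maximal, of length given by \<^const>\<open>last\<close>.\<close>

definition left :: "nat list \<Rightarrow> nat list" where
  "left a = (if hd a = 2 then dropWhile ((=) 1) (tl a) else (hd a - 1) # tl a)"

definition left_weight :: "nat list \<Rightarrow> nat" where
  "left_weight a = (if hd a = 2 then 2 + length (takeWhile ((=) 1) (tl a)) else 1)"

definition both :: "nat list \<Rightarrow> nat list" where
  "both a = butlast (left a)"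

text \<open>The right block is measured after the left removal, since the two blocks can overlap in
  the word of a one-part composition.\<close>

definition both_weight :: "nat list \<Rightarrow> nat" where
  "both_weight a = left_weight a + (if left a = [] then 0 else last (left a))"

section \<open>Admissibility, weight and words under removal of blocks\<close>

lemma takeWhile_eq_replicate: "takeWhile ((=) x) xs = replicate (length (takeWhile ((=) x) xs)) x"
  by (induction xs) auto

lemma admissible_left:
  assumes "admissible a" "a \<noteq> []"
  shows "admissible (left a)"
proof -
  obtain k c where a: "a = k # c" using assms(2) by (cases a) auto
  have k: "k \<ge> 2" "composition c" using assms(1) by (auto simp: a admissible_def composition_def)
  have "2 \<le> hd (dropWhile ((=) 1) c)" if "dropWhile ((=) 1) c \<noteq> []"
  proof -
    have "hd (dropWhile ((=) 1) c) \<noteq> 1" using hd_dropWhile[OF that] by auto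
    moreover have "hd (dropWhile ((=) 1) c) \<in> set c"
      using that by (metis hd_in_set set_dropWhileD)
    ultimately show ?thesis using k(2) by (fastforce simp: composition_def)
  qed
  moreover have "composition (dropWhile ((=) 1) c)"
    using k(2) by (auto simp: composition_def dest: set_dropWhileD)
  ultimately show ?thesis
    using k by (auto simp: left_def a admissible_def composition_def)
qed

lemma admissible_butlast: "admissible a \<Longrightarrow> admissible (butlast a)"
  by (cases a) (auto simp: admissible_def composition_def dest: in_set_butlastD)

lemma admissible_both: "admissible a \<Longrightarrow> a \<noteq> [] \<Longrightarrow> admissible (both a)"
  unfolding both_def by (intro admissible_butlast admissible_left)

lemma admissible_last_pos: "admissible a \<Longrightarrow> a \<noteq> [] \<Longrightarrow> 0 < last a"
  by (auto simp: admissible_def composition_def)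

lemma admissible_sum_list_ge_2: "admissible a \<Longrightarrow> a \<noteq> [] \<Longrightarrow> 2 \<le> sum_list a"
  by (cases a) (auto simp: admissible_def)

lemma sum_list_butlast: "a \<noteq> [] \<Longrightarrow> last a + sum_list (butlast a) = sum_list (a :: nat list)"
  by (metis add.commute append_butlast_last_id sum_list.append sum_list.Cons sum_list.Nil add_0_right)

lemma sum_list_left:
  assumes "admissible a" "a \<noteq> []"
  shows "left_weight a + sum_list (left a) = sum_list a"
proof -
  obtain k c where a: "a = k # c" using assms(2) by (cases a) auto
  have "sum_list c = sum_list (takeWhile ((=) 1) c) + sum_list (dropWhile ((=) 1) c)"
    by (metis sum_list.append takeWhile_dropWhile_id)
  moreover have "sum_list (takeWhile ((=) 1) c) = length (takeWhile ((=) 1) c)"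
    by (subst takeWhile_eq_replicate) (simp add: sum_list_replicate)
  ultimately show ?thesis
    using assms(1) by (auto simp: a left_def left_weight_def admissible_def)
qed

lemma sum_list_both:
  "admissible a \<Longrightarrow> a \<noteq> [] \<Longrightarrow> both_weight a + sum_list (both a) = sum_list a"
  using sum_list_left[of a] sum_list_butlast[of "left a"]
  by (auto simp: both_def both_weight_def)

lemma left_weight_pos: "0 < left_weight a"
  by (simp add: left_weight_def)

lemma both_weight_pos: "0 < both_weight a"
  using left_weight_pos by (simp add: both_weight_def)

lemma word_append: "word (a @ b) = word a @ word b"
  by (simp add: word_def)

lemma word_eq_left:
  assumes "admissible a" "a \<noteq> []"
  shows "word a = (False # replicate (left_weight a - 1) True) @ word (left a)"
proof -
  obtain k c where a: "a = k # c" using assms(2) by (cases a) auto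
  have k: "k \<ge> 2" using assms(1) by (auto simp: a admissible_def)
  show ?thesis
  proof (cases "k = 2")
    case True
    have r: "word (replicate p 1) = replicate p True" for p
      by (induction p) (simp_all add: word_Cons)
    have "word c = word (takeWhile ((=) 1) c) @ word (dropWhile ((=) 1) c)"
      by (metis word_append takeWhile_dropWhile_id)
    then have "word c = replicate (length (takeWhile ((=) 1) c)) True @ word (dropWhile ((=) 1) c)"
      using r takeWhile_eq_replicate[of 1 c] by metis
    then show ?thesis using True by (simp add: a left_def left_weight_def word_Cons numeral_2_eq_2)
  next
    case False
    then have "k - 1 = Suc (k - 2)" using k by simp
    then show ?thesis using False by (simp add: a left_def left_weight_def word_Cons)
  qed
qed

lemma word_eq_butlast:
  assumes "a \<noteq> []"
  shows "word a = word (butlast a) @ (replicate (last a - 1) False @ [True])"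
proof -
  have "word a = word (butlast a @ [last a])" using assms by simp
  then show ?thesis unfolding word_append by (simp add: word_Cons)
qed

lemma last_left:
  assumes "admissible a" "left a \<noteq> []" "butlast a \<noteq> []"
  shows "last (left a) = last a"
proof -
  obtain k c where a: "a = k # c" "c \<noteq> []" using assms(3) by (cases a) (auto split: if_splits)
  have "last (dropWhile ((=) 1) c) = last c" if "dropWhile ((=) 1) c \<noteq> []"
    by (metis that last_appendR takeWhile_dropWhile_id)
  then show ?thesis using a assms(2) by (auto simp: left_def)
qed

text \<open>\<open>coefficient a J\<close> is the coefficient of the nested sum \<open>T\<^sub>J\<close> in \<open>\<zeta>(a)\<^sub>n\<^sub>,\<^sub>n\<close>.\<close>

primrec coefficient :: "nat list \<Rightarrow> nat list \<Rightarrow> nat" where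
  "coefficient a [] = (if a = [] then 1 else 0)"
| "coefficient a (j # J) = (if a = [] then 0 else
     (if j = left_weight a then coefficient (left a) J else 0)
   + (if j = last a then coefficient (butlast a) J else 0)
   + (if j = both_weight a then coefficient (both a) J else 0))"

declare coefficient.simps [simp del]

section \<open>Support of the coefficients\<close>

lemma coefficient_Nil: "coefficient [] J = (if J = [] then 1 else 0)"
  by (cases J) (auto simp: coefficient.simps)

text \<open>Applying \<open>left\<close> until nothing remains records a suitable \<open>J\<close>;
  coefficients are natural numbers, so no other contribution can cancel it.\<close>

lemma coefficient_nonzero:
  assumes "admissible a"
  shows "\<exists>J. coefficient a J \<noteq> 0"
  using assms
proof (induction "sum_list a" arbitrary: a rule: less_induct)
  case less
  show ?case
  proof (cases "a = []")
    case True
    then show ?thesis by (intro exI[of _ "[]"]) (simp add: coefficient_Nil)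
  next
    case False
    then have "sum_list (left a) < sum_list a"
      using sum_list_left[OF less.prems] left_weight_pos[of a] by linarith
    then obtain J where "coefficient (left a) J \<noteq> 0"
      using less.hyps admissible_left[OF less.prems False] by blast
    then show ?thesis
      using False by (intro exI[of _ "left_weight a # J"]) (simp add: coefficient.simps)
  qed
qed

text \<open>Each index records the number of letters removed, and the letters are exhausted at the
  end.\<close>

lemma coefficient_sum_list:
  "admissible a \<Longrightarrow> coefficient a J \<noteq> 0 \<Longrightarrow> sum_list J = sum_list a"
proof (induction J arbitrary: a)
  case Nil
  then show ?case by (auto simp: coefficient.simps split: if_splits)
next
  case (Cons j J)
  then have a: "a \<noteq> []" by (auto simp: coefficient.simps)
  note ad = admissible_left[OF Cons.prems(1) a] admissible_butlast[OF Cons.prems(1)]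
    admissible_both[OF Cons.prems(1) a]
  note sm = sum_list_left[OF Cons.prems(1) a] sum_list_butlast[OF a] sum_list_both[OF Cons.prems(1) a]
  consider "j = left_weight a" "coefficient (left a) J \<noteq> 0" | "j = last a" "coefficient (butlast a) J \<noteq> 0"
    | "j = both_weight a" "coefficient (both a) J \<noteq> 0"
    using Cons.prems(2) a by (auto simp: coefficient.simps split: if_splits)
  then show ?case
  proof cases
    case 1
    then show ?thesis using Cons.IH[OF ad(1)] sm(1) by simp
  next
    case 2
    then show ?thesis using Cons.IH[OF ad(2)] sm(2) by simp
  next
    case 3
    then show ?thesis using Cons.IH[OF ad(3)] sm(3) by simp
  qed
qed

lemma coefficient_pos_parts:
  "admissible a \<Longrightarrow> coefficient a J \<noteq> 0 \<Longrightarrow> 0 \<notin> set J"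
proof (induction J arbitrary: a)
  case (Cons j J)
  then have a: "a \<noteq> []" by (auto simp: coefficient.simps)
  note ad = admissible_left[OF Cons.prems(1) a] admissible_butlast[OF Cons.prems(1)]
    admissible_both[OF Cons.prems(1) a]
  have "0 < j" "\<exists>b. admissible b \<and> coefficient b J \<noteq> 0"
    using Cons.prems(2) a left_weight_pos[of a] both_weight_pos[of a] ad
      admissible_last_pos[OF Cons.prems(1) a]
    by (auto simp: coefficient.simps split: if_splits)
  then show ?case using Cons.IH by auto
qed simp

text \<open>The last index removes a whole non-empty admissible word, which has at least two
  letters. This supplies the condition on \<open>last\<close> in the independence theorem.\<close>

lemma coefficient_last_ge_2:
  "admissible a \<Longrightarrow> coefficient a J \<noteq> 0 \<Longrightarrow> J \<noteq> [] \<Longrightarrow> 2 \<le> last J"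
proof (induction J arbitrary: a)
  case (Cons j J)
  then have a: "a \<noteq> []" by (auto simp: coefficient.simps)
  show ?case
  proof (cases "J = []")
    case True
    then have "j = sum_list a" using coefficient_sum_list[OF Cons.prems(1,2)] by simp
    then show ?thesis using admissible_sum_list_ge_2[OF Cons.prems(1) a] True by simp
  next
    case False
    have "\<exists>b. admissible b \<and> coefficient b J \<noteq> 0"
      using Cons.prems(2) a admissible_left[OF Cons.prems(1) a] admissible_butlast[OF Cons.prems(1)]
        admissible_both[OF Cons.prems(1) a]
      by (auto simp: coefficient.simps split: if_splits)
    then show ?thesis using False Cons.IH by auto
  qed
qed simp

section \<open>Duality and one-sided words\<close>

lemma dual_word_append_block:
  "dual_word (w @ (replicate q False @ [True])) = (False # replicate q True) @ dual_word w"
  by (simp add: dual_word_def)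

lemma dual_word_block_append:
  "dual_word ((False # replicate p True) @ w) = dual_word w @ (replicate p False @ [True])"
  by (simp add: dual_word_def map_replicate)

lemma count_list_replicate: "count_list (replicate n x) y = (if x = y then n else 0)"
  by (induction n) auto

text \<open>Besides those of \<open>w\<close>, the left side contains \<open>q\<close> zeros and the
  right side only one.\<close>

lemma suffix_conjugate_imp:
  assumes "w @ (replicate q False @ [True]) = (False # replicate q True) @ w"
  shows "q = 1"
  using arg_cong[OF assms, of "\<lambda>u. count_list u False"]
  by (simp add: count_list_append count_list_replicate)

lemma eq_or_dual_of_word_eq:
  assumes "admissible a" "admissible b" "word b = word a \<or> word b = dual_word (word a)"
  shows "b = a \<or> b = dual a"
  using assms word_inj[of b a] word_inj[of b "dual a"] word_dual[OF assms(1)] admissible_dual[OF assms(1)]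
  by (auto simp: admissible_def)

text \<open>The two one-sided words \<open>01\<^sup>p\<close> and \<open>0\<^sup>q1\<close> are dual to each other and are the only ones for
  which \<open>T\<^sub>[\<^sub>k\<^sub>]\<close> occurs with coefficient greater than 1.\<close>

definition one_sided :: "nat list \<Rightarrow> bool" where
  "one_sided a \<longleftrightarrow> left a = [] \<or> butlast a = []"

lemma left_eq_Nil_imp_word: 
  assumes "admissible a" "a \<noteq> []" "left a = []"
  shows "word a = False # replicate (sum_list a - 1) True"
  using word_eq_left[OF assms(1,2)] sum_list_left[OF assms(1,2)] assms(3) by simp

lemma butlast_eq_Nil_imp_word: 
  assumes "a \<noteq> []" "butlast a = []"
  shows "word a = replicate (sum_list a - 1) False @ [True]"
  using word_eq_butlast[OF assms(1)] sum_list_butlast[OF assms(1)] assms(2) by simp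

text \<open>The coefficient counts which of the three removals leave nothing. If \<open>left\<close>
  or \<open>butlast\<close> does, so does \<open>both\<close>, giving at least 2; otherwise only
  \<open>both\<close> can contribute.\<close>

lemma one_sided_iff:
  assumes "admissible a" "a \<noteq> []"
  shows "one_sided a \<longleftrightarrow> 2 \<le> coefficient a [sum_list a]"
proof -
  note s = sum_list_left[OF assms] sum_list_butlast[OF assms(2)] sum_list_both[OF assms]
  note ad = admissible_left[OF assms] admissible_butlast[OF assms(1)] admissible_both[OF assms]
  have z: "sum_list c = 0 \<longleftrightarrow> c = []" if "admissible c" for c
    using admissible_sum_list_ge_2[OF that] by fastforce
  have "sum_list a = left_weight a \<longleftrightarrow> left a = []" "sum_list a = last a \<longleftrightarrow> butlast a = []"
    "sum_list a = both_weight a \<longleftrightarrow> both a = []"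
    using s z[OF ad(1)] z[OF ad(2)] z[OF ad(3)] by linarith+
  then have c: "coefficient a [sum_list a] = (if left a = [] then 1 else 0)
      + (if butlast a = [] then 1 else 0) + (if both a = [] then 1 else 0)"
    using assms(2) by (simp add: coefficient.simps)
  have "both a = []" if "left a = []" using that by (simp add: both_def)
  moreover have "both a = []" if "butlast a = []"
  proof -
    have "a = [last a]" using assms(2) that by (metis append_butlast_last_id append_Nil)
    then obtain k where "a = [k]" by blast
    then show ?thesis by (simp add: both_def left_def)
  qed
  ultimately show ?thesis unfolding c one_sided_def by auto
qed

lemma two_sided_decomposition:
  assumes "admissible a" "a \<noteq> []" "\<not> one_sided a"
  shows "both_weight a = left_weight a + last a"
    and "word a = (False # replicate (left_weight a - 1) True) @ word (both a)
        @ (replicate (last a - 1) False @ [True])"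
    and "word (left a) = word (both a) @ (replicate (last a - 1) False @ [True])"
    and "word (butlast a) = (False # replicate (left_weight a - 1) True) @ word (both a)"
proof -
  have ne: "left a \<noteq> []" "butlast a \<noteq> []" using assms(3) by (auto simp: one_sided_def)
  note l = last_left[OF assms(1) ne]
  show "both_weight a = left_weight a + last a" using ne l by (simp add: both_weight_def)
  show w: "word (left a) = word (both a) @ (replicate (last a - 1) False @ [True])"
    using word_eq_butlast[OF ne(1)] l by (simp add: both_def)
  show w2: "word a = (False # replicate (left_weight a - 1) True) @ word (both a)
        @ (replicate (last a - 1) False @ [True])"
    using word_eq_left[OF assms(1,2)] w by simp
  show "word (butlast a) = (False # replicate (left_weight a - 1) True) @ word (both a)"
    using word_eq_butlast[OF assms(2)] w2 by (metis append.assoc append_same_eq)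
qed

text \<open>The largest \<open>j\<close> with \<open>coefficient a (j # J) \<noteq> 0\<close> for some \<open>J\<close> determines what remains of the word
  after removing blocks at both ends; the smaller ones determine the unordered pair of block lengths.\<close>

lemma coefficient_two_sided:
  assumes "admissible a" "a \<noteq> []" "\<not> one_sided a"
  shows "coefficient a (j # J) =
     (if j = left_weight a then coefficient (left a) J else 0)
   + (if j = last a then coefficient (butlast a) J else 0)
   + (if j = left_weight a + last a then coefficient (both a) J else 0)"
  using assms(2) two_sided_decomposition(1)[OF assms] by (simp add: coefficient.simps)

lemma coefficient_determines_word:
  assumes "admissible a" "admissible b" "coefficient a = coefficient b"
  shows "word b = word a \<or> word b = dual_word (word a)"
  using assms
proof (induction "sum_list a" arbitrary: a b rule: less_induct)
  case less
  note a = less.prems(1) and b = less.prems(2) and eq = less.prems(3)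
  have c: "coefficient a J = coefficient b J" for J using eq by simp
  obtain J0 where J0: "coefficient a J0 \<noteq> 0" using coefficient_nonzero[OF a] by blast
  have s: "sum_list b = sum_list a"
    using coefficient_sum_list[OF a J0] coefficient_sum_list[OF b, of J0] J0 c[of J0] by simp
  show ?case
  proof (cases "a = []")
    case True
    then have "\<not> 2 \<le> sum_list b" unfolding s by simp
    then have "b = []" using admissible_sum_list_ge_2[OF b] by blast
    then show ?thesis using True by simp
  next
    case a0: False
    then have "2 \<le> sum_list b" unfolding s by (rule admissible_sum_list_ge_2[OF a])
    then have b0: "b \<noteq> []" by auto
    have os: "one_sided a \<longleftrightarrow> one_sided b"
      unfolding one_sided_iff[OF a a0] one_sided_iff[OF b b0] s eq ..
    show ?thesis
    proof (cases "one_sided a")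
      case True
      \<comment> \<open>There are only two one-sided words of a given length, and they are dual to
        each other.\<close>
      have "word d \<in> {False # replicate (sum_list a - 1) True, replicate (sum_list a - 1) False @ [True]}"
        if "d \<noteq> []" "admissible d" "one_sided d" "sum_list d = sum_list a" for d
        using that left_eq_Nil_imp_word[of d] butlast_eq_Nil_imp_word[of d] by (auto simp: one_sided_def)
      from this[OF a0 a True refl] this[OF b0 b _ s] show ?thesis
        using True os dual_word_block_append[of "sum_list a - 1" "[]"]
          dual_word_append_block[of "[]" "sum_list a - 1"] by (auto simp: dual_word_def[of "[]"])
    next
      case ta: False
      then have tb: "\<not> one_sided b" using os by simp
      define x y x' y' where "x = left_weight a" "y = last a" "x' = left_weight b" "y' = last b"
      note defs = this
      have pos: "x > 0" "y > 0" "x' > 0" "y' > 0"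
        using left_weight_pos admissible_last_pos a b a0 b0 by (auto simp: defs)
      note da = two_sided_decomposition[OF a a0 ta, folded defs]
      have da_dual: "dual_word (word a) = (False # replicate (y - 1) True) @ dual_word (word (both a))
          @ (replicate (x - 1) False @ [True])"
        unfolding da(2) dual_word_block_append dual_word_append_block by simp
      note db = two_sided_decomposition[OF b b0 tb, folded defs]
      note ca = coefficient_two_sided[OF a a0 ta, folded defs]
      note cb = coefficient_two_sided[OF b b0 tb, folded defs]
      note ad = admissible_left[OF a a0] admissible_butlast[OF a] admissible_both[OF a a0]
        admissible_left[OF b b0] admissible_butlast[OF b] admissible_both[OF b b0]
      note nz = ad[THEN coefficient_nonzero]
      have lt: "sum_list (left a) < sum_list a" "sum_list (butlast a) < sum_list a"
          "sum_list (both a) < sum_list a"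
        using sum_list_left[OF a a0] sum_list_butlast[OF a0] sum_list_both[OF a a0]
          left_weight_pos[of a] both_weight_pos[of a] pos(2) defs by linarith+
      \<comment> \<open>The first indices occurring for \<open>a\<close> are x, y and their sum,
        which is strictly the largest. Comparing with \<open>b\<close> in both directions equates
        the two maxima.\<close>
      have "x' + y' \<le> x + y"
      proof -
        obtain J where "coefficient (both b) J \<noteq> 0" using nz(6) by blast
        then have "coefficient a ((x' + y') # J) \<noteq> 0" unfolding c cb by simp
        then show ?thesis unfolding ca by (auto split: if_splits)
      qed
      moreover have "x + y \<le> x' + y'"
      proof -
        obtain J where "coefficient (both a) J \<noteq> 0" using nz(3) by blast
        then have "coefficient b ((x + y) # J) \<noteq> 0" unfolding c[symmetric] ca by simp
        then show ?thesis unfolding cb by (auto split: if_splits)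
      qed
      ultimately have xy: "x' + y' = x + y" by simp
      have "coefficient (both a) J = coefficient (both b) J" for J
        using c[of "(x + y) # J"] pos xy unfolding ca cb by (auto split: if_splits)
      then have IHb: "word (both b) = word (both a) \<or> word (both b) = dual_word (word (both a))"
        using less.hyps[OF lt(3) ad(3) ad(6)] by blast
      \<comment> \<open>The index x also occurs for \<open>b\<close> and lies below the common
        maximum, so it is one of the two block lengths of \<open>b\<close>.\<close>
      have "x = x' \<or> x = y'"
      proof -
        obtain J where "coefficient (left a) J \<noteq> 0" using nz(1) by blast
        then have "coefficient b (x # J) \<noteq> 0" unfolding c[symmetric] ca by simp
        then show ?thesis using pos xy unfolding cb by (auto split: if_splits)
      qed
      then consider "x' = x" "y' = y" "x = y" | "x' = x" "y' = y" "x \<noteq> y" | "x' = y" "y' = x" "x \<noteq> y"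
        using xy by fastforce
      then show ?thesis
      proof cases
        case 1
        \<comment> \<open>For equal block lengths, dualizing the whole word keeps the outer blocks
          and dualizes the inner word, so either alternative for the inner word of \<open>b\<close>
          fits.\<close>
        then show ?thesis using IHb da(2) db(2) da_dual by auto
      next
        case 2
        \<comment> \<open>Since x and y differ, index x isolates \<open>left\<close> and index y
          isolates \<open>butlast\<close>, in \<open>a\<close> and \<open>b\<close> alike.\<close>
        have "coefficient (left a) J = coefficient (left b) J" 
          "coefficient (butlast a) J = coefficient (butlast b) J" for J
          using c[of "x # J"] c[of "y # J"] pos 2 unfolding ca cb by (auto split: if_splits)
        then have "word (left b) = word (left a) \<or> word (left b) = dual_word (word (left a))"
          "word (butlast b) = word (butlast a) \<or> word (butlast b) = dual_word (word (butlast a))"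
          using less.hyps[OF lt(1) ad(1) ad(4)] less.hyps[OF lt(2) ad(2) ad(5)] by blast+
        note IH = this[unfolded da(3,4) db(3,4) dual_word_append_block dual_word_block_append 2(1,2)]
        show ?thesis
        proof (cases "word (both b) = word (both a)")
          case True
          then show ?thesis using da(2) db(2) 2 by simp
        next
          case False
          \<comment> \<open>The inner word of \<open>b\<close> is now the dual of that of
            \<open>a\<close> and not equal to it, so \<open>left\<close> and \<open>butlast\<close>
            must be dualized as well. Both resulting word equations have the form of
            \<open>suffix_conjugate_imp\<close>, which forces equal block lengths.\<close>
          then have "y - 1 = 1" "x - 1 = 1"
            using IH IHb suffix_conjugate_imp by (metis append_same_eq, metis same_append_eq)
          then show ?thesis using 2(3) by simp
        qed
      next
        case 3
        \<comment> \<open>Mirror image of the previous case, with \<open>a\<close> replaced by its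
          dual, which exchanges the two ends.\<close>
        have "coefficient (left a) J = coefficient (butlast b) J" 
          "coefficient (butlast a) J = coefficient (left b) J" for J
          using c[of "x # J"] c[of "y # J"] pos 3 unfolding ca cb by (auto split: if_splits)
        then have "word (butlast b) = word (left a) \<or> word (butlast b) = dual_word (word (left a))"
          "word (left b) = word (butlast a) \<or> word (left b) = dual_word (word (butlast a))"
          using less.hyps[OF lt(1) ad(1) ad(5)] less.hyps[OF lt(2) ad(2) ad(4)] by blast+
        note IH = this[unfolded da(3,4) db(3,4) dual_word_append_block dual_word_block_append 3(1,2)]
        show ?thesis
        proof (cases "word (both b) = dual_word (word (both a))")
          case True
          then show ?thesis using da_dual db(2) 3 by simp
        next
          case False
          then have "y - 1 = 1" "x - 1 = 1"
            using IH IHb suffix_conjugate_imp by (metis same_append_eq, metis append_same_eq)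
          then show ?thesis using 3(3) by simp
        qed
      qed
    qed
  qed
qed

section \<open>Linear independence of nested sums\<close>

text \<open>The order is opposite to that of the zeta series: the first exponent belongs to the
  smallest index, so a step in \<open>n\<close> splits off the head of the list.\<close>

primrec nested :: "nat list \<Rightarrow> nat \<Rightarrow> real" where
  "nested [] n = 1 / real ((2 * n) choose n)"
| "nested (j # J) n = (\<Sum>i. nested J (Suc (n + i)) / real (Suc (n + i)) ^ j)"

section \<open>Size and difference equations of nested sums\<close>

lemma central_binomial_Suc:
  "Suc m * ((2 * Suc m) choose Suc m) = 2 * (2 * m + 1) * ((2 * m) choose m)"
proof -
  have "Suc m * ((2 * Suc m) choose Suc m) = Suc m * (2 * ((2 * m + 1) choose m))"
    using Suc_times_binomial_eq[of "2 * m + 1" m] by (simp del: binomial_Suc_Suc add: algebra_simps)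
  also have "\<dots> = 2 * (2 * m + 1) * ((2 * m) choose m)"
    using binomial_absorb_comp[of "2 * m + 1" m] by simp
  finally show ?thesis .
qed

lemma nested_Nil_Suc: "real (Suc m) * nested [] m = 2 * (2 * real (Suc m) - 1) * nested [] (Suc m)"
proof -
  have "real (Suc m) * real ((2 * Suc m) choose Suc m) = 2 * (2 * real (Suc m) - 1) * real ((2 * m) choose m)"
    using arg_cong[OF central_binomial_Suc[of m], of real]
    by (simp del: binomial_Suc_Suc add: algebra_simps)
  moreover have "real ((2 * Suc m) choose Suc m) > 0" "real ((2 * m) choose m) > 0"
    by (simp_all del: binomial_Suc_Suc)
  ultimately show ?thesis
    by (simp add: field_simps del: binomial_Suc_Suc of_nat_Suc mult_Suc_right)
qed

text \<open>Each step of \<open>n\<close> at least halves the inverse central binomial. The bound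
  then reproduces itself, since the powers of 1/2 with exponents above n sum to (1/2)^n.\<close>

lemma nested_bounds: "0 \<le> nested J n \<and> nested J n \<le> (1 / 2) ^ n"
proof (induction J arbitrary: n)
  case Nil
  have "nested [] n \<le> (1 / 2) ^ n"
  proof (induction n)
    case (Suc n)
    have "2 * real (Suc n) * nested [] (Suc n) \<le> 2 * (2 * real (Suc n) - 1) * nested [] (Suc n)"
      by (intro mult_right_mono) auto
    also have "\<dots> = real (Suc n) * nested [] n" using nested_Nil_Suc[of n] by simp
    finally have "real (Suc n) * (2 * nested [] (Suc n)) \<le> real (Suc n) * nested [] n" by (simp only: mult.assoc mult.left_commute)
    then have "2 * nested [] (Suc n) \<le> nested [] n" by (simp only: mult_le_cancel_left_pos of_nat_0_less_iff zero_less_Suc)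
    then show ?case using Suc.IH by simp
  qed simp
  then show ?case by simp
next
  case (Cons j J)
  let ?f = "\<lambda>i. nested J (Suc (n + i)) / real (Suc (n + i)) ^ j"
  let ?g = "\<lambda>i. (1 / 2 :: real) ^ n * (1 / 2) ^ Suc i"
  have f0: "0 \<le> ?f i" for i using Cons by simp
  have fg: "?f i \<le> ?g i" for i
  proof -
    have "?f i \<le> nested J (Suc (n + i)) / 1"
      using Cons by (intro divide_left_mono) (auto simp del: of_nat_Suc)
    also have "\<dots> \<le> (1 / 2) ^ Suc (n + i)" using Cons[of "Suc (n + i)"] by simp
    finally show ?thesis by (simp add: power_add)
  qed
  have g: "?g sums ((1 / 2) ^ n * 1)"
    by (intro sums_mult power_half_series)
  have sf: "summable ?f"
  proof (rule summable_comparison_test'[OF sums_summable[OF g], of 0])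
    show "norm (?f i) \<le> ?g i" for i using f0[of i] fg[of i] by (simp only: real_norm_def abs_of_nonneg)
  qed
  have "suminf ?f \<le> suminf ?g" by (rule suminf_le[OF fg sf sums_summable[OF g]])
  then show ?case using sums_unique[OF g] suminf_nonneg[OF sf f0] by simp
qed

lemma nested_nonneg: "0 \<le> nested J n"
  by (rule conjunct1[OF nested_bounds])

lemma nested_le: "nested J n \<le> (1 / 2) ^ n"
  by (rule conjunct2[OF nested_bounds])

lemma nested_tendsto_0: "nested J \<longlonglongrightarrow> 0"
proof (rule Lim_null_comparison)
  show "\<forall>\<^sub>F n in sequentially. norm (nested J n) \<le> (1 / 2) ^ n"
    using nested_nonneg nested_le by (simp add: abs_of_nonneg)
  show "(\<lambda>n. (1 / 2 :: real) ^ n) \<longlonglongrightarrow> 0" by (rule LIMSEQ_realpow_zero) auto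
qed

lemma nested_Nil_pos: "0 < nested [] n"
  by simp

lemma nested_Cons_Suc:
  "nested (j # J) n = nested (j # J) (Suc n) + nested J (Suc n) / real (Suc n) ^ j"
proof -
  let ?f = "\<lambda>i. nested J (Suc (n + i)) / real (Suc (n + i)) ^ j"
  have "summable ?f"
  proof (rule summable_comparison_test'[of "\<lambda>i. (1 / 2) ^ i" 0])
    fix i
    have "?f i \<le> nested J (Suc (n + i)) / 1"
      by (intro divide_left_mono) (auto simp del: of_nat_Suc simp: nested_nonneg)
    also have "\<dots> \<le> (1 / 2) ^ Suc (n + i)" using nested_le[of J "Suc (n + i)"] by simp
    also have "\<dots> \<le> (1 / 2) ^ i" by (intro power_decreasing) auto
    finally show "norm (?f i) \<le> (1 / 2) ^ i" using nested_nonneg[of J "Suc (n + i)"] by simp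
  qed (simp add: summable_geometric)
  from suminf_split_head[OF this] show ?thesis by simp
qed

section \<open>Finite index sets of exponent lists\<close>

definition bounded_lists :: "nat \<Rightarrow> nat \<Rightarrow> nat list set" where
  "bounded_lists K r = {J. set J \<subseteq> {1..K} \<and> length J \<le> r}"

lemma finite_bounded_lists [simp]: "finite (bounded_lists K r)"
  unfolding bounded_lists_def by (rule finite_lists_length_le) simp

lemma bounded_lists_0 [simp]: "bounded_lists K 0 = {[]}"
  by (auto simp: bounded_lists_def)

lemma bounded_lists_Suc: "bounded_lists K (Suc r) = insert [] ((\<lambda>(J, j). j # J) ` (bounded_lists K r \<times> {1..K}))"
  (is "?L = ?R")
proof (rule set_eqI)
  fix J show "J \<in> ?L \<longleftrightarrow> J \<in> ?R" by (cases J) (auto simp: bounded_lists_def image_iff)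
qed

lemma sum_bounded_lists_Suc:
  "(\<Sum>J\<in>bounded_lists K (Suc r). f J) = f [] + (\<Sum>J\<in>bounded_lists K r. \<Sum>j=1..K. f (j # J))"
proof -
  have "(\<Sum>J\<in>bounded_lists K (Suc r). f J) = f [] + (\<Sum>J\<in>(\<lambda>(J, j). j # J) ` (bounded_lists K r \<times> {1..K}). f J)"
    unfolding bounded_lists_Suc by (rule sum.insert) auto
  also have "(\<Sum>J\<in>(\<lambda>(J, j). j # J) ` (bounded_lists K r \<times> {1..K}). f J)
      = (\<Sum>(J, j)\<in>bounded_lists K r \<times> {1..K}. f (j # J))"
    by (subst sum.reindex) (auto simp: inj_on_def intro!: sum.cong)
  finally show ?thesis by (simp add: sum.cartesian_product)
qed

section \<open>Polynomials, their translates and their behaviour near 0\<close>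

lemma poly_eq_0_if_nat_roots:
  fixes p :: "real poly"
  assumes "\<And>n. n \<ge> N \<Longrightarrow> poly p (real n) = 0"
  shows "p = 0"
proof (rule ccontr)
  assume "p \<noteq> 0"
  then have "finite (real ` {N..})"
    by (rule finite_subset[OF _ poly_roots_finite, rotated]) (use assms in auto)
  then show False using infinite_Ici[of N] by (simp add: finite_image_iff)
qed

definition shift :: "real poly \<Rightarrow> real poly" where
  "shift p = p \<circ>\<^sub>p [:-1, 1:]"

lemma poly_shift [simp]: "poly (shift p) x = poly p (x - 1)"
  by (simp add: shift_def poly_pcompose)

lemma shift_0 [simp]: "shift 0 = 0"
  by (simp add: shift_def)

lemma eventually_poly_nonzero:
  fixes p :: "real poly"
  assumes "p \<noteq> 0"
  shows "\<forall>\<^sub>F x in at 0. poly p (x + c) \<noteq> 0"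
proof -
  have "{x. poly p (x + c) = 0} = (\<lambda>y. y - c) ` {y. poly p y = 0}"
    by (force simp: image_iff)
  then have "finite {x. poly p (x + c) = 0}" using poly_roots_finite[OF assms] by simp
  then have "\<not> 0 islimpt {x. poly p (x + c) = 0}" by (rule islimpt_finite)
  then show ?thesis by (simp add: islimpt_iff_eventually)
qed

lemma exists_nat_beyond_roots:
  fixes p :: "real poly"
  assumes "p \<noteq> 0"
  obtains N :: nat where "\<And>x. real N \<le> \<bar>x\<bar> \<Longrightarrow> poly p x \<noteq> 0"
proof -
  have "finite (abs ` {x. poly p x = 0})" using poly_roots_finite[OF assms] by simp
  then have "bdd_above (abs ` {x. poly p x = 0})" by (rule bdd_above_finite)
  then obtain M where M: "\<And>x. poly p x = 0 \<Longrightarrow> \<bar>x\<bar> \<le> M"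
    unfolding bdd_above_def by blast
  obtain N :: nat where "real N > M" using reals_Archimedean2 by blast
  with M have "\<And>x. real N \<le> \<bar>x\<bar> \<Longrightarrow> poly p x \<noteq> 0" by fastforce
  then show ?thesis by (rule that)
qed

text \<open>The rational function p/D has period 1 and is therefore constant: its value at an
  integer beyond the roots of \<open>D\<close> is carried to all larger integers.\<close>

lemma shift_proportional_imp:
  assumes "D \<noteq> 0" "D * shift p = shift D * p"
  shows "\<exists>c. p = smult c D"
proof -
  obtain N where N: "\<And>x. real N \<le> \<bar>x\<bar> \<Longrightarrow> poly D x \<noteq> 0"
    using exists_nat_beyond_roots[OF assms(1)] by blast
  define c where "c = poly p (real N) / poly D (real N)"
  have e: "poly D x * poly p (x - 1) = poly D (x - 1) * poly p x" for x
    using arg_cong[OF assms(2), of "\<lambda>q. poly q x"] by simp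
  have "poly p (real n) = c * poly D (real n)" if "n \<ge> N" for n
    using that
  proof (induction n rule: dec_induct)
    case base
    then show ?case using N[of "real N"] by (simp add: c_def)
  next
    case (step n)
    have "poly D (real (Suc n)) * poly p (real n) = poly D (real n) * poly p (real (Suc n))"
      using e[of "real (Suc n)"] by simp
    moreover have "poly D (real n) \<noteq> 0" using N[of "real n"] step by simp
    ultimately show ?case using step.IH by (simp add: field_simps)
  qed
  then have "p - smult c D = 0" by (intro poly_eq_0_if_nat_roots[of N]) simp
  then show ?thesis by auto
qed

text \<open>Letting x tend to 0 kills the constant coefficient; dividing by x lowers the
  exponent.\<close>

lemma poly_bigo_power_imp_coeff_0:
  fixes p :: "real poly"
  assumes "poly p \<in> O[at 0](\<lambda>x. x ^ e)" "i < e"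
  shows "coeff p i = 0"
  using assms
proof (induction e arbitrary: p i)
  case 0
  from 0(2) show ?case by simp
next
  case (Suc e)
  obtain b q where p: "p = pCons b q" by (cases p)
  obtain c where c: "\<forall>\<^sub>F x in at 0. norm (poly p x) \<le> c * norm (x ^ Suc e)"
    using Suc.prems(1) by (elim landau_o.bigE)
  have "((\<lambda>x::real. c * norm (x ^ Suc e)) \<longlongrightarrow> c * norm (0 ^ Suc e :: real)) (at 0)"
    by (intro tendsto_intros)
  then have "(poly p \<longlongrightarrow> 0) (at 0)"
    using c by (intro Lim_null_comparison[OF c]) simp
  moreover have "(poly p \<longlongrightarrow> poly p 0) (at 0)" using poly_isCont[of 0 p] by (rule isContD)
  ultimately have "poly p 0 = 0" by (intro tendsto_unique[of "at 0" "poly p"]) auto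
  then have b: "b = 0" by (simp add: p)
  have "\<forall>\<^sub>F x in at 0. norm (poly q x) \<le> c * norm (x ^ e)"
    using c eventually_neq_at_within[of 0 0]
  proof eventually_elim
    case (elim x)
    then have "\<bar>x\<bar> * norm (poly q x) \<le> \<bar>x\<bar> * (c * norm (x ^ e))"
      by (simp add: p b abs_mult mult_ac)
    then show ?case using elim by simp
  qed
  then have "poly q \<in> O[at 0](\<lambda>x. x ^ e)" by (rule bigoI)
  then have "coeff q k = 0" if "k < e" for k using Suc.IH that by blast
  then show ?case using Suc.prems(2) by (cases i) (auto simp: p b)
qed

text \<open>A pole of \<open>q\<close> at an integer would propagate along the recurrence, away from 0, to infinitely many
  integers.\<close>

lemma recurrence_bounded_near_0:
  fixes q A M :: "real \<Rightarrow> real"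
  assumes rec: "\<And>i::int. \<forall>\<^sub>F x in at 0. A (x + of_int i) * q (x + of_int (i - 1))
      = (x + of_int i) * q (x + of_int i) - M (x + of_int i)"
    and A: "\<And>i::int. isCont A (of_int i)" "\<And>i::int. i \<ge> 1 \<Longrightarrow> A (of_int i) \<noteq> 0"
    and M: "\<And>i::int. i \<noteq> 0 \<Longrightarrow> isCont M (of_int i)"
    and q: "\<And>i::int. \<bar>i\<bar> \<ge> int N \<Longrightarrow> (\<lambda>x. q (x + of_int i)) \<in> O[at 0](\<lambda>_. 1)"
  shows "q \<in> O[at 0](\<lambda>_. 1)" and "(\<lambda>x. q (x - 1)) \<in> O[at 0](\<lambda>_. 1)"
proof -
  have cont: "(\<lambda>x. f (x + of_int i)) \<in> O[at 0](\<lambda>_. 1)" if "isCont f (of_int i)"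
    for f :: "real \<Rightarrow> real" and i :: int
  proof (rule bigoI_tendsto)
    have "isCont (\<lambda>x. f (x + of_int i)) 0"
      by (rule isCont_o2[where f = "\<lambda>x. x + of_int i"]) (use that in auto)
    then show "((\<lambda>x. f (x + of_int i) / 1) \<longlongrightarrow> f (of_int i)) (at 0)" by (simp add: isCont_def)
  qed auto
  \<comment> \<open>At positive integers the recurrence is solved for the value of \<open>q\<close>
    one step to the left, dividing by \<open>A\<close>.\<close>
  have down: "(\<lambda>x. q (x + of_int (i - 1))) \<in> O[at 0](\<lambda>_. 1)"
    if "i \<ge> 1" "(\<lambda>x. q (x + of_int i)) \<in> O[at 0](\<lambda>_. 1)" for i :: int
  proof -
    have inv: "(\<lambda>x. inverse (A (x + of_int i))) \<in> O[at 0](\<lambda>_. 1)"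
      using A(1)[of i] A(2)[OF that(1)]
      by (intro cont[where f = "\<lambda>x. inverse (A x)"] continuous_at_within_inverse)
    have id: "(\<lambda>x. x + of_int i) \<in> O[at 0](\<lambda>_. 1 :: real)"
      by (rule cont[where f = "\<lambda>x. x"]) simp
    have M': "(\<lambda>x. M (x + of_int i)) \<in> O[at 0](\<lambda>_. 1)" using M that(1) by (intro cont) auto
    have "(\<lambda>x. ((x + of_int i) * q (x + of_int i) - M (x + of_int i)) * inverse (A (x + of_int i))) \<in> O[at 0](\<lambda>_. 1)"
      by (rule landau_o.big.mult_in_1[OF sum_in_bigo(2)[OF landau_o.big.mult_in_1[OF id that(2)] M'] inv])
    moreover have "\<forall>\<^sub>F x in at 0. A (x + of_int i) \<noteq> 0"
    proof -
      have "((\<lambda>x. A (x + of_int i)) \<longlongrightarrow> A (of_int i)) (at 0)"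
        using A(1)[of i] by (simp add: isCont_def LIM_offset_zero_iff add.commute)
      then show ?thesis using A(2)[OF that(1)] by (rule tendsto_imp_eventually_ne)
    qed
    then have "\<forall>\<^sub>F x in at 0. ((x + of_int i) * q (x + of_int i) - M (x + of_int i)) * inverse (A (x + of_int i))
        = q (x + of_int (i - 1))"
      using rec[of i] by eventually_elim (simp add: field_simps)
    ultimately show ?thesis by (simp only: landau_o.big.in_cong)
  qed
  \<comment> \<open>At negative integers it is solved for the value on the right, dividing by
    \<open>x + of_int i\<close>.\<close>
  have up: "(\<lambda>x. q (x + of_int i)) \<in> O[at 0](\<lambda>_. 1)"
    if "i \<le> -1" "(\<lambda>x. q (x + of_int (i - 1))) \<in> O[at 0](\<lambda>_. 1)" for i :: int
  proof -
    have inv: "(\<lambda>x. inverse (x + of_int i)) \<in> O[at 0](\<lambda>_. 1 :: real)"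
      using that(1) by (intro cont[where f = "\<lambda>x. inverse x"]) (auto intro!: continuous_intros)
    have A': "(\<lambda>x. A (x + of_int i)) \<in> O[at 0](\<lambda>_. 1)" using A by (intro cont)
    have M': "(\<lambda>x. M (x + of_int i)) \<in> O[at 0](\<lambda>_. 1)" using M that(1) by (intro cont) auto
    have "(\<lambda>x. (A (x + of_int i) * q (x + of_int (i - 1)) + M (x + of_int i)) * inverse (x + of_int i)) \<in> O[at 0](\<lambda>_. 1)"
      by (rule landau_o.big.mult_in_1[OF sum_in_bigo(1)[OF landau_o.big.mult_in_1[OF A' that(2)] M'] inv])
    moreover have "\<forall>\<^sub>F x in at 0. x + of_int i \<noteq> (0 :: real)"
    proof -
      have "((\<lambda>x::real. x + of_int i) \<longlongrightarrow> 0 + of_int i) (at 0)" by (intro tendsto_intros)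
      then show ?thesis by (rule tendsto_imp_eventually_ne) (use that(1) in auto)
    qed
    then have "\<forall>\<^sub>F x in at 0. (A (x + of_int i) * q (x + of_int (i - 1)) + M (x + of_int i)) * inverse (x + of_int i)
        = q (x + of_int i)"
      using rec[of i] by eventually_elim (simp add: field_simps)
    ultimately show ?thesis by (simp only: landau_o.big.in_cong)
  qed
  \<comment> \<open>The descent from N ends at 0 and the ascent below ends at -1. The recurrence at
    0, where \<open>M\<close> may have a pole, is never crossed.\<close>
  have "(\<lambda>x. q (x + of_int (int N - int k))) \<in> O[at 0](\<lambda>_. 1)" if "k \<le> N" for k
    using that
  proof (induction k)
    case (Suc k)
    then show ?case using down[of "int N - int k"] by (simp add: algebra_simps)
  qed (use q[of "int N"] in simp)
  from this[of N] show "q \<in> O[at 0](\<lambda>_. 1)" by simp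
  have "(\<lambda>x. q (x + of_int (- int (Suc N) + int k))) \<in> O[at 0](\<lambda>_. 1)" if "k \<le> N" for k
    using that
  proof (induction k)
    case (Suc k)
    then show ?case using up[of "- int N + int k"] by (simp add: algebra_simps)
  qed (use q[of "- int (Suc N)"] in simp)
  from this[of N] show "(\<lambda>x. q (x - 1)) \<in> O[at 0](\<lambda>_. 1)" by simp
qed

text \<open>With q = P/D the equation reads A(x) q(x-1) - x q(x) = - \<Sum> c_j x^(1-j). The left
  side is bounded near 0, so no pole can occur on the right.\<close>

lemma rational_recurrence_coeffs_0:
  fixes P D A :: "real poly" and c :: "nat \<Rightarrow> real"
  assumes D: "D \<noteq> 0" and K: "K \<ge> 1"
    and A: "\<And>i::int. i \<ge> 1 \<Longrightarrow> poly A (of_int i) \<noteq> 0"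
    and eq: "\<And>x. x ^ (K - 1) * (poly A x * poly D x * poly P (x - 1) - x * poly D (x - 1) * poly P x)
        + poly D x * poly D (x - 1) * (\<Sum>j=1..K. c j * x ^ (K - j)) = 0"
    and j: "j \<in> {1..K}" "j \<ge> 2 \<or> A = [:0, 1:]"
  shows "c j = 0"
proof -
  define q where "q x = poly P x / poly D x" for x
  define C where "C = (\<Sum>j=1..K. monom (c j) (K - j))"
  define M where "M x = - poly C x / x ^ (K - 1)" for x :: real
  have C: "poly C x = (\<Sum>j=1..K. c j * x ^ (K - j))" for x
    by (simp add: C_def poly_sum poly_monom)
  have "coeff C (K - j) = (\<Sum>i=1..K. if i = j then c i else 0)"
    unfolding C_def coeff_sum using j(1) by (intro sum.cong) auto
  then have cj: "coeff C (K - j) = c j" using j(1) by simp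
  have rec0: "x ^ (K - 1) * (poly A x * q (x - 1) - x * q x) = - poly C x"
    if "poly D x \<noteq> 0" "poly D (x - 1) \<noteq> 0" for x
  proof -
    have "poly D x * poly D (x - 1) * (x ^ (K - 1) * (poly A x * q (x - 1) - x * q x) + poly C x) = 0"
      using eq[of x, folded C] that by (simp add: q_def field_simps)
    then show ?thesis using that by (simp add: eq_neg_iff_add_eq_0)
  qed
  have evD: "\<forall>\<^sub>F x in at 0. poly D (x + of_int i) \<noteq> 0 \<and> poly D (x + of_int i - 1) \<noteq> 0 \<and> x + of_int i \<noteq> 0" for i :: int
    using eventually_poly_nonzero[OF D, of "of_int i"] eventually_poly_nonzero[OF D, of "of_int i - 1"]
      eventually_poly_nonzero[of "[:0, 1:]" "of_int i"]
    by (auto simp: eventually_conj_iff algebra_simps)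
  have rec: "\<forall>\<^sub>F x in at 0. poly A (x + of_int i) * q (x + of_int (i - 1))
      = (x + of_int i) * q (x + of_int i) - (- M (x + of_int i))" for i :: int
    using evD[of i]
  proof eventually_elim
    case (elim x)
    then show ?case using rec0[of "x + of_int i"] by (simp add: M_def field_simps)
  qed
  obtain N where N: "\<And>x. real N \<le> \<bar>x\<bar> \<Longrightarrow> poly D x \<noteq> 0"
    using exists_nat_beyond_roots[OF D] by blast
  have qN: "(\<lambda>x. q (x + of_int i)) \<in> O[at 0](\<lambda>_. 1)" if "\<bar>i\<bar> \<ge> int N" for i :: int
  proof (rule bigoI_tendsto)
    have "poly D (of_int i) \<noteq> 0" using that by (intro N) linarith
    then show "((\<lambda>x. q (x + of_int i) / 1) \<longlongrightarrow> poly P (0 + of_int i) / poly D (0 + of_int i)) (at 0)"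
      unfolding q_def div_by_1 by (intro tendsto_intros) auto
  qed auto
  have bd: "q \<in> O[at 0](\<lambda>_. 1)" "(\<lambda>x. q (x - 1)) \<in> O[at 0](\<lambda>_. 1)"
    by (auto intro!: recurrence_bounded_near_0[where A = "poly A" and M = "\<lambda>x. - M x" and N = N, OF rec _ A _ qN]
        continuous_intros simp: M_def)
  have id: "(\<lambda>x. x) \<in> O[at 0](\<lambda>_. 1 :: real)"
    by (rule bigoI_tendsto[of _ _ 0]) auto
  have A1: "poly A \<in> O[at 0](\<lambda>_. 1)"
    by (rule bigoI_tendsto[of _ _ "poly A 0"]) (use poly_isCont[of 0 A] in \<open>auto simp: isCont_def\<close>)
  have ev: "\<forall>\<^sub>F x in at 0. x ^ (K - 1) * (poly A x * q (x - 1) - x * q x) = - poly C x"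
    using evD[of 0] by eventually_elim (use rec0 in auto)
  show ?thesis
  proof (cases "A = [:0, 1:]")
    \<comment> \<open>Here \<open>j\<close> is at least 2, so the order of vanishing K-1 exceeds
      K-j.\<close>
    case False
    have "(\<lambda>x. poly A x * q (x - 1) - x * q x) \<in> O[at 0](\<lambda>_. 1)"
      by (intro sum_in_bigo landau_o.big.mult_in_1 A1 bd id)
    then have "(\<lambda>x. x ^ (K - 1) * (poly A x * q (x - 1) - x * q x)) \<in> O[at 0](\<lambda>x. x ^ (K - 1) * 1)"
      by (rule landau_o.big.mult_left)
    then have "(\<lambda>x. - poly C x) \<in> O[at 0](\<lambda>x. x ^ (K - 1))"
      using landau_o.big.in_cong[OF ev] by simp
    then have "coeff C (K - j) = 0"
      using j False K by (intro poly_bigo_power_imp_coeff_0[of C "K - 1"]) auto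
    then show ?thesis using cj by simp
  next
    \<comment> \<open>For A = x a further factor x splits off the left side, so the coefficient with
      \<open>j\<close> = 1 is reached too.\<close>
    case True
    have "(\<lambda>x. q (x - 1) - q x) \<in> O[at 0](\<lambda>_. 1)"
      by (intro sum_in_bigo bd)
    then have "(\<lambda>x. x ^ K * (q (x - 1) - q x)) \<in> O[at 0](\<lambda>x. x ^ K * 1)"
      by (rule landau_o.big.mult_left)
    moreover have "x ^ (K - 1) * (poly A x * q (x - 1) - x * q x) = x ^ K * (q (x - 1) - q x)" for x
      using K by (cases K) (simp_all add: True algebra_simps)
    ultimately have "(\<lambda>x. - poly C x) \<in> O[at 0](\<lambda>x. x ^ K)"
      using landau_o.big.in_cong[OF ev] by simp
    then have "coeff C (K - j) = 0"
      using j K by (intro poly_bigo_power_imp_coeff_0[of C K]) auto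
    then show ?thesis using cj by simp
  qed
qed

text \<open>A relation with polynomial coefficients that involves the fewest words of maximal length \<open>r\<close> is
  combined with its translate so as to eliminate one of these words. By minimality the result is trivial,
  which makes the coefficients of the longest words proportional and turns the vanishing of the
  coefficient of a word of length \<open>r - 1\<close> into a rational recurrence.\<close>

lemma nested_independent:
  fixes p :: "nat list \<Rightarrow> real poly"
  assumes K: "K \<ge> 1"
    and rel: "\<And>n. n \<ge> N \<Longrightarrow> (\<Sum>J\<in>bounded_lists K r. poly (p J) (real n) * nested J n) = 0"
    and last: "\<And>J. J \<noteq> [] \<Longrightarrow> last J < 2 \<Longrightarrow> p J = 0"
    and J: "J \<in> bounded_lists K r"
  shows "p J = 0"
  using rel last J
proof (induction r arbitrary: p N J)
  case 0
  have "poly (p []) (real n) = 0" if "n \<ge> N" for n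
    using 0(1)[OF that] nested_Nil_pos[of n] by (simp del: nested.simps)
  then have "p [] = 0" by (rule poly_eq_0_if_nat_roots)
  then show ?case using 0(3) by simp
next
  case (Suc r)
  note outer_IH = Suc.IH
  from Suc.prems show ?case
  proof (induction "card {J \<in> bounded_lists K (Suc r). length J = Suc r \<and> p J \<noteq> 0}" arbitrary: p N J
      rule: less_induct)
    case less
    note rel = less.prems(1) and last = less.prems(2)
    have sub: "bounded_lists K r \<subseteq> bounded_lists K (Suc r)" by (auto simp: bounded_lists_def)
    show ?case
    proof (cases "\<exists>J\<in>bounded_lists K (Suc r). length J = Suc r \<and> p J \<noteq> 0")
      \<comment> \<open>No word of maximal length remains, so the relation falls under the outer
        induction on \<open>r\<close>.\<close>
      case False
      have out: "p I = 0" if "I \<in> bounded_lists K (Suc r) - bounded_lists K r" for I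
        using that False by (auto simp: bounded_lists_def)
      have "(\<Sum>J\<in>bounded_lists K r. poly (p J) (real n) * nested J n) = 0" if "n \<ge> N" for n
        using rel[OF that] sum.mono_neutral_left[OF finite_bounded_lists sub, of "\<lambda>J. poly (p J) (real n) * nested J n"] out
        by simp
      then have "p I = 0" if "I \<in> bounded_lists K r" for I using outer_IH last that by blast
      then show ?thesis using out less.prems(3) by blast
    next
      case True
      then obtain J0 where J0: "J0 \<in> bounded_lists K (Suc r)" "length J0 = Suc r" "p J0 \<noteq> 0" by blast
      define D where "D = p J0"
      have D: "D \<noteq> 0" using J0 by (simp add: D_def)
      \<comment> \<open>\<open>A\<close> is the factor in passing from n-1 to n after multiplication
        by x = n: 4x - 2 for the inverse central binomial, x otherwise. \<open>E\<close> collects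
        what longer words contribute by losing their head.\<close>
      define A where "A J = (if J = [] then [:-2, 4:] else [:0, 1:] :: real poly)" for J :: "nat list"
      define E where "E J = (if length J \<le> r then \<Sum>j=1..K. monom 1 (K - j) * shift (p (j # J)) else 0)"
        for J :: "nat list"
      \<comment> \<open>These are the coefficients of x^K D(x) times the relation at x-1 minus x^K
        D(x-1) times the relation at x. The power x^K clears all denominators, and the choice of
        \<open>D\<close> makes the coefficient of \<open>J0\<close> vanish.\<close>
      define p' where "p' J = [:0, 1:] ^ (K - 1) * (A J * D * shift (p J) - [:0, 1:] * shift D * p J) + D * E J"
        for J
      have step: "x ^ K * nested I m = x ^ (K - 1) * poly (A I) x * nested I (Suc m)
          + (if I = [] then 0 else x ^ (K - hd I) * nested (tl I) (Suc m))"
        if "I \<in> bounded_lists K (Suc r)" "x = real (Suc m)" for I m x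
      proof (cases I)
        case Nil
        have "x ^ K * nested [] m = x ^ (K - 1) * (x * nested [] m)"
          using K by (cases K) simp_all
        also have "\<dots> = x ^ (K - 1) * (2 * (2 * x - 1) * nested [] (Suc m))"
          using nested_Nil_Suc[of m] that(2) by (simp only:)
        finally show ?thesis by (simp add: Nil A_def algebra_simps del: nested.simps)
      next
        case (Cons j I')
        have j: "j \<le> K" using that(1) by (auto simp: Cons bounded_lists_def)
        have x: "x > 0" using that(2) by simp
        have "x ^ K = x ^ (K - j) * x ^ j" using j by (simp flip: power_add)
        then have "x ^ K * (nested I' (Suc m) / x ^ j) = x ^ (K - j) * nested I' (Suc m)"
          using x by simp
        moreover have "x ^ K = x ^ (K - 1) * x" using K by (cases K) simp_all
        ultimately show ?thesis
          using nested_Cons_Suc[of j I' m] that(2)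
          by (simp add: Cons A_def ring_distribs del: nested.simps of_nat_Suc)
      qed
      have rel': "(\<Sum>J\<in>bounded_lists K (Suc r). poly (p' J) (real n) * nested J n) = 0" if n: "n \<ge> Suc N" for n
      proof -
        obtain m where m: "n = Suc m" "m \<ge> N" using n by (cases n) auto
        define x where "x = real n"
        have x1: "x - 1 = real m" by (simp add: x_def m)
        let ?B = "bounded_lists K (Suc r)"
        have s1: "(\<Sum>J\<in>?B. poly D x * poly (p J) (x - 1) * (x ^ K * nested J m)) = 0"
        proof -
          have "(\<Sum>J\<in>?B. poly D x * poly (p J) (x - 1) * (x ^ K * nested J m))
            = poly D x * x ^ K * (\<Sum>J\<in>?B. poly (p J) (real m) * nested J m)"
            unfolding sum_distrib_left x1 by (intro sum.cong) (simp_all add: mult_ac)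
          then show ?thesis using rel[OF m(2)] by simp
        qed
        have s2: "(\<Sum>J\<in>?B. poly D (x - 1) * poly (p J) x * (x ^ K * nested J n)) = 0"
        proof -
          have "(\<Sum>J\<in>?B. poly D (x - 1) * poly (p J) x * (x ^ K * nested J n))
            = poly D (x - 1) * x ^ K * (\<Sum>J\<in>?B. poly (p J) (real n) * nested J n)"
            unfolding sum_distrib_left x_def by (intro sum.cong) (simp_all add: mult_ac)
          then show ?thesis using rel[of n] n by simp
        qed
        have s3: "(\<Sum>J\<in>?B. poly D x * poly (E J) x * nested J n)
            = (\<Sum>J\<in>?B. poly D x * poly (p J) (x - 1) * (if J = [] then 0 else x ^ (K - hd J) * nested (tl J) n))"
        proof -
          have "(\<Sum>J\<in>?B. poly D x * poly (E J) x * nested J n)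
              = (\<Sum>J\<in>bounded_lists K r. poly D x * poly (E J) x * nested J n)"
            by (intro sum.mono_neutral_right sub finite_bounded_lists) (auto simp: bounded_lists_def E_def)
          also have "\<dots> = (\<Sum>J\<in>bounded_lists K r. \<Sum>j=1..K. poly D x * poly (p (j # J)) (x - 1) * (x ^ (K - j) * nested J n))"
          proof (rule sum.cong)
            fix J assume "J \<in> bounded_lists K r"
            then have "E J = (\<Sum>j=1..K. monom 1 (K - j) * shift (p (j # J)))" by (simp add: E_def bounded_lists_def)
            then show "poly D x * poly (E J) x * nested J n
                = (\<Sum>j=1..K. poly D x * poly (p (j # J)) (x - 1) * (x ^ (K - j) * nested J n))"
              by (simp add: poly_sum poly_monom sum_distrib_left sum_distrib_right mult_ac)
          qed simp
          finally show ?thesis by (simp add: sum_bounded_lists_Suc)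
        qed
        have "(\<Sum>J\<in>?B. poly (p' J) x * nested J n)
            = (\<Sum>J\<in>?B. poly D x * poly (p J) (x - 1) * (x ^ (K - 1) * poly (A J) x * nested J n))
            - (\<Sum>J\<in>?B. poly D (x - 1) * poly (p J) x * (x ^ K * nested J n))
            + (\<Sum>J\<in>?B. poly D x * poly (E J) x * nested J n)"
        proof -
          have "x ^ K = x ^ (K - 1) * x" using K by (cases K) simp_all
          then show ?thesis
            unfolding p'_def sum_subtractf[symmetric] sum.distrib[symmetric]
            by (intro sum.cong) (simp_all add: algebra_simps)
        qed
        also have "\<dots> = (\<Sum>J\<in>?B. poly D x * poly (p J) (x - 1) * (x ^ K * nested J m)) 
            - (\<Sum>J\<in>?B. poly D (x - 1) * poly (p J) x * (x ^ K * nested J n))"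
        proof -
          have "(\<Sum>J\<in>?B. poly D x * poly (p J) (x - 1) * (x ^ K * nested J m))
            = (\<Sum>J\<in>?B. poly D x * poly (p J) (x - 1) * (x ^ (K - 1) * poly (A J) x * nested J n)
             + poly D x * poly (p J) (x - 1) * (if J = [] then 0 else x ^ (K - hd J) * nested (tl J) n))"
          proof (rule sum.cong)
            fix J assume "J \<in> ?B"
            from step[OF this, of x m] show "poly D x * poly (p J) (x - 1) * (x ^ K * nested J m)
              = poly D x * poly (p J) (x - 1) * (x ^ (K - 1) * poly (A J) x * nested J n)
             + poly D x * poly (p J) (x - 1) * (if J = [] then 0 else x ^ (K - hd J) * nested (tl J) n)"
              by (simp only: x_def m ring_distribs refl)
          qed simp
          then show ?thesis unfolding s3 by (simp add: sum.distrib)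
        qed
        finally show ?thesis using s1 s2 by (simp add: x_def)
      qed
      \<comment> \<open>Prepending an index to a non-empty list keeps its last entry, so the
        condition is inherited.\<close>
      have last': "p' I = 0" if "I \<noteq> []" "last I < 2" for I
        using that last by (simp add: p'_def E_def)
      have top: "p' I = [:0, 1:] ^ K * (D * shift (p I) - shift D * p I)" if "length I = Suc r" for I
      proof -
        have "[:0, 1:] ^ K = [:0, 1:] ^ (K - 1) * ([:0, 1:] :: real poly)"
          using K by (cases K) (simp_all add: mult.commute)
        then show ?thesis using that by (auto simp: p'_def E_def A_def algebra_simps simp del: mult_pCons_left mult_pCons_right)
      qed
      have "{J \<in> bounded_lists K (Suc r). length J = Suc r \<and> p' J \<noteq> 0}
          \<subset> {J \<in> bounded_lists K (Suc r). length J = Suc r \<and> p J \<noteq> 0}"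
      proof
        show "{J \<in> bounded_lists K (Suc r). length J = Suc r \<and> p' J \<noteq> 0}
            \<subseteq> {J \<in> bounded_lists K (Suc r). length J = Suc r \<and> p J \<noteq> 0}"
          using top by auto
        have "p' J0 = 0" using top[OF J0(2)] by (simp add: D_def mult.commute)
        then show "{J \<in> bounded_lists K (Suc r). length J = Suc r \<and> p' J \<noteq> 0}
            \<noteq> {J \<in> bounded_lists K (Suc r). length J = Suc r \<and> p J \<noteq> 0}"
          using J0 by blast
      qed
      then have "card {J \<in> bounded_lists K (Suc r). length J = Suc r \<and> p' J \<noteq> 0}
          < card {J \<in> bounded_lists K (Suc r). length J = Suc r \<and> p J \<noteq> 0}"
        by (intro psubset_card_mono) simp_all
      from less.hyps[OF this rel' last'] have p'0: "p' I = 0" if "I \<in> bounded_lists K (Suc r)" for I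
        using that by blast
      obtain j0 J' where J': "J0 = j0 # J'" using J0(2) by (cases J0) auto
      have j0: "j0 \<in> {1..K}" "J' \<in> bounded_lists K r" "length J' = r"
        using J0 by (auto simp: J' bounded_lists_def)
      \<comment> \<open>All words sharing the tail of \<open>J0\<close> have coefficients
        proportional to \<open>D\<close>, so \<open>D\<close> factors out of the term
        \<open>E J'\<close>.\<close>
      have "\<exists>c. p (j # J') = smult c D" if "j \<in> {1..K}" for j
      proof (rule shift_proportional_imp[OF D])
        have "j # J' \<in> bounded_lists K (Suc r)" "length (j # J') = Suc r" using that j0 by (auto simp: bounded_lists_def)
        then have "[:0, 1:] ^ K * (D * shift (p (j # J')) - shift D * p (j # J')) = 0"
          using p'0 top by metis
        then show "D * shift (p (j # J')) = shift D * p (j # J')" by simp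
      qed
      then obtain c where c: "\<And>j. j \<in> {1..K} \<Longrightarrow> p (j # J') = smult (c j) D" by metis
      have eq: "x ^ (K - 1) * (poly (A J') x * poly D x * poly (p J') (x - 1) - x * poly D (x - 1) * poly (p J') x)
        + poly D x * poly D (x - 1) * (\<Sum>j=1..K. c j * x ^ (K - j)) = 0" for x
      proof -
        have "poly (p' J') x = 0" using p'0 j0 sub by (metis poly_0 subsetD)
        moreover have "poly (E J') x = poly D (x - 1) * (\<Sum>j=1..K. c j * x ^ (K - j))"
        proof -
          have "poly (E J') x = (\<Sum>j=1..K. x ^ (K - j) * poly (p (j # J')) (x - 1))"
            using j0(3) by (simp add: E_def poly_sum poly_monom)
          also have "\<dots> = (\<Sum>j=1..K. poly D (x - 1) * (c j * x ^ (K - j)))"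
            by (intro sum.cong) (simp_all only: c poly_smult mult_ac)
          finally show ?thesis by (simp add: sum_distrib_left)
        qed
        ultimately show ?thesis by (simp add: p'_def algebra_simps)
      qed
      \<comment> \<open>If \<open>J'\<close> is empty, \<open>j0\<close> is the last entry of
        \<open>J0\<close>, and the hypothesis on \<open>last\<close> excludes 1.\<close>
      have "j0 \<ge> 2 \<or> A J' = [:0, 1:]"
        using last[of J0] J0(3) by (cases "J' = []") (auto simp: A_def J' not_less[symmetric])
      moreover have "poly (A J') (of_int i) \<noteq> 0" if "i \<ge> 1" for i :: int
      proof -
        have "real_of_int i \<ge> 1" using that by simp
        then show ?thesis by (auto simp: A_def)
      qed
      ultimately have "c j0 = 0"
        using rational_recurrence_coeffs_0[OF D K _ eq j0(1)] by blast
      then show ?thesis using c[OF j0(1)] J0(3) J' by simp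
    qed
  qed
qed

section \<open>Expansion of double tails in nested sums\<close>

text \<open>\<open>tail_Suc_left\<close> lowers the first part. If it becomes 1, it and all ones
  following it are summed out by \<open>tail_1_Cons\<close>, each giving a factor 1/(m+1).\<close>

lemma tail_left:
  assumes "m > 0" "admissible a" "a \<noteq> []"
  shows "tail a m n = tail a (Suc m) n + tail (left a) (Suc m) n / real (Suc m) ^ left_weight a"
proof -
  obtain k c where a: "a = k # c" using assms(3) by (cases a) auto
  have k: "k \<ge> 2" and c: "composition c" using assms(2) by (auto simp: a admissible_def composition_def)
  have strip: "tail d (Suc m) n = tail (dropWhile ((=) 1) d) (Suc m) n / real (Suc m) ^ length (takeWhile ((=) 1) d)"
    if "composition d" for d
    using that
  proof (induction d)
    case (Cons i d)
    then have "composition d" by (simp add: composition_def)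
    then have "tail (1 # d) (Suc m) n
        = tail (dropWhile ((=) 1) d) (Suc m) n / real (Suc m) ^ length (takeWhile ((=) 1) d) / real (Suc m)"
      using Cons.IH tail_1_Cons[of "Suc m" d n] by simp
    then show ?case by (cases "i = 1") (simp_all add: mult.commute del: of_nat_Suc)
  qed simp
  have "tail ((k - 1) # c) (Suc m) n / real (Suc m) = tail (left a) (Suc m) n / real (Suc m) ^ left_weight a"
  proof (cases "k = 2")
    case True
    then show ?thesis
      using tail_1_Cons[of "Suc m" c n] strip[OF c] c
      by (simp add: a left_def left_weight_def power2_eq_square field_simps del: of_nat_Suc)
  qed (simp add: a left_def left_weight_def)
  then show ?thesis using tail_Suc_left[OF assms(1) k c, of n] by (simp add: a)
qed

text \<open>The step in \<open>m\<close> is followed by the step in \<open>n\<close> for each of the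
  two resulting tails; the term with both removals comes from \<open>left a\<close>.\<close>

lemma tail_diagonal:
  assumes "n > 0" "admissible a" "a \<noteq> []"
  shows "tail a n n = tail a (Suc n) (Suc n)
    + tail (left a) (Suc n) (Suc n) / real (Suc n) ^ left_weight a
    + tail (butlast a) (Suc n) (Suc n) / real (Suc n) ^ last a
    + tail (both a) (Suc n) (Suc n) / real (Suc n) ^ both_weight a"
proof -
  let ?N = "Suc n"
  have comp: "composition a" "composition (left a)"
    using assms admissible_left[OF assms(2,3)] by (auto simp: admissible_def)
  have "tail (left a) ?N n / real ?N ^ left_weight a = tail (left a) ?N ?N / real ?N ^ left_weight a
      + tail (both a) ?N ?N / real ?N ^ both_weight a"
  proof (cases "left a = []")
    case True
    \<comment> \<open>With nothing left to cut on the right, the central binomial is twice its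
      neighbour, which yields one equal term for \<open>left\<close> and one for
      \<open>both\<close>.\<close>
    have "Suc n * ((?N + ?N) choose ?N) = Suc n * (2 * ((n + ?N) choose ?N))"
      using Suc_times_binomial_eq[of "n + ?N" n] binomial_symmetric[of n "n + ?N"]
      by (simp del: binomial_Suc_Suc add: algebra_simps)
    then have "(?N + ?N) choose ?N = 2 * ((n + ?N) choose ?N)" by (simp only: mult_cancel1) simp
    then have "tail [] ?N n = 2 * tail [] ?N ?N" by (simp del: binomial_Suc_Suc)
    then show ?thesis using True by (simp add: both_def both_weight_def del: tail_Nil of_nat_Suc)
  next
    case False
    then show ?thesis
      using tail_Suc_right[OF _ comp(2) False, of ?N n]
      by (simp add: both_def both_weight_def power_add add_divide_distrib mult.commute del: of_nat_Suc)
  qed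
  then show ?thesis
    using tail_left[OF assms, of n] tail_Suc_right[OF _ comp(1) assms(3), of ?N n] by simp
qed

text \<open>Both sides satisfy the same difference equation in \<open>n\<close> and tend to
  0.\<close>

lemma zeta_nn_eq_sum_nested:
  assumes "admissible a" "sum_list a \<le> K" "sum_list a \<le> r" "n > 0"
  shows "zeta_nn a n = (\<Sum>J\<in>bounded_lists K r. real (coefficient a J) * nested J n)"
  using assms
proof (induction "sum_list a" arbitrary: a r n rule: less_induct)
  case less
  note ad = less.prems(1)
  show ?case
  proof (cases "a = []")
    case True
    have "(\<Sum>J\<in>bounded_lists K r. real (coefficient a J) * nested J n)
        = (\<Sum>J\<in>bounded_lists K r. if J = [] then nested J n else 0)"
      by (intro sum.cong) (simp_all add: True coefficient_Nil)
    also have "\<dots> = nested [] n"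
      unfolding sum.delta[OF finite_bounded_lists] by (simp add: bounded_lists_def)
    finally show ?thesis by (simp add: True zeta_nn_def)
  next
    case False
    have "sum_list a \<ge> 2" using admissible_sum_list_ge_2[OF ad False] .
    \<comment> \<open>Splitting off the head of \<open>J\<close> lowers the length bound, and each
      removal lowers the weight, so the induction hypothesis applies with \<open>s\<close>.\<close>
    then obtain s where r: "r = Suc s" using less.prems(3) by (cases r) auto
    define g where "g n = (\<Sum>J\<in>bounded_lists K r. real (coefficient a J) * nested J n)" for n
    note moves = admissible_left[OF ad False] admissible_butlast[OF ad] admissible_both[OF ad False]
    note sums = sum_list_left[OF ad False] sum_list_butlast[OF False] sum_list_both[OF ad False]
    note pos = left_weight_pos[of a] admissible_last_pos[OF ad False] both_weight_pos[of a]
    have step: "zeta_nn a n - zeta_nn a (Suc n) = g n - g (Suc n)" if "n > 0" for n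
    proof -
      have IH: "tail b (Suc n) (Suc n) = (\<Sum>J\<in>bounded_lists K s. real (coefficient b J) * nested J (Suc n))"
        if "admissible b" "j + sum_list b = sum_list a" "j > 0" for b j
        using less.hyps[of b s "Suc n"] that less.prems r by (simp add: zeta_nn_eq_tail)
      have pick: "(\<Sum>j=1..K. (if j = i then u else 0) * w j) = (u * w i :: real)" if "0 < i" "i \<le> K" for i u w
        using that by (simp add: if_distrib[of "\<lambda>x. x * _"] sum.delta cong: if_cong)
      have le: "left_weight a \<le> K" "last a \<le> K" "both_weight a \<le> K"
        using sums less.prems(2) by linarith+
      have "g n - g (Suc n) = (\<Sum>J\<in>bounded_lists K s. \<Sum>j=1..K.
          real (coefficient a (j # J)) * (nested J (Suc n) / real (Suc n) ^ j))"
        unfolding g_def r sum_bounded_lists_Suc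
        by (simp add: coefficient.simps(1) False nested_Cons_Suc[of _ _ n] ring_distribs sum.distrib
            del: nested.simps of_nat_Suc)
      also have "\<dots> = (\<Sum>J\<in>bounded_lists K s. real (coefficient (left a) J) * (nested J (Suc n) / real (Suc n) ^ left_weight a)
          + real (coefficient (butlast a) J) * (nested J (Suc n) / real (Suc n) ^ last a)
          + real (coefficient (both a) J) * (nested J (Suc n) / real (Suc n) ^ both_weight a))"
      proof (rule sum.cong)
        fix J
        have "real (coefficient a (j # J)) = (if j = left_weight a then real (coefficient (left a) J) else 0)
          + (if j = last a then real (coefficient (butlast a) J) else 0)
          + (if j = both_weight a then real (coefficient (both a) J) else 0)" for j
          by (simp add: coefficient.simps False)
        then show "(\<Sum>j=1..K. real (coefficient a (j # J)) * (nested J (Suc n) / real (Suc n) ^ j))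
          = real (coefficient (left a) J) * (nested J (Suc n) / real (Suc n) ^ left_weight a)
          + real (coefficient (butlast a) J) * (nested J (Suc n) / real (Suc n) ^ last a)
          + real (coefficient (both a) J) * (nested J (Suc n) / real (Suc n) ^ both_weight a)"
          by (simp only: distrib_right sum.distrib pick[OF pos(1) le(1)] pick[OF pos(2) le(2)] pick[OF pos(3) le(3)])
      qed simp
      also have "\<dots> = tail (left a) (Suc n) (Suc n) / real (Suc n) ^ left_weight a
        + tail (butlast a) (Suc n) (Suc n) / real (Suc n) ^ last a
        + tail (both a) (Suc n) (Suc n) / real (Suc n) ^ both_weight a"
        unfolding IH[OF moves(1) sums(1) pos(1)] IH[OF moves(2) sums(2) pos(2)] IH[OF moves(3) sums(3) pos(3)]
        by (simp add: sum.distrib sum_divide_distrib del: of_nat_Suc)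
      finally show ?thesis using tail_diagonal[OF that ad False] by (simp add: zeta_nn_eq_tail)
    qed
    \<comment> \<open>The difference of the two sides is constant from \<open>n\<close> on, so it
      equals its limit 0.\<close>
    have const: "zeta_nn a (n + i) - g (n + i) = zeta_nn a n - g n" for i
    proof (induction i)
      case (Suc i)
      then show ?case using step[of "n + i"] less.prems(4) by simp
    qed simp
    have "g \<longlonglongrightarrow> (\<Sum>J\<in>bounded_lists K r. real (coefficient a J) * 0)"
      unfolding g_def by (intro tendsto_sum tendsto_mult tendsto_const nested_tendsto_0)
    moreover have "zeta_nn a \<longlonglongrightarrow> 0"
    proof (rule Lim_null_comparison[OF _ nested_tendsto_0[of "[]"]])
      have "zeta_nn a n \<le> nested [] n" if "n > 0" for n
        using tail_le[OF that, of a n] ad by (simp add: zeta_nn_eq_tail admissible_def mult_2)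
      then show "\<forall>\<^sub>F n in sequentially. norm (zeta_nn a n) \<le> nested [] n"
        using tail_nonneg[of a] by (auto simp: eventually_sequentially zeta_nn_eq_tail intro!: exI[of _ 1] simp del: nested.simps)
    qed
    ultimately have "(\<lambda>n. zeta_nn a n - g n) \<longlonglongrightarrow> 0" by (auto intro: tendsto_eq_intros)
    then have "(\<lambda>i. zeta_nn a (n + i) - g (n + i)) \<longlonglongrightarrow> 0"
      using LIMSEQ_ignore_initial_segment[of _ 0 n] by (simp add: add.commute)
    then have "zeta_nn a n - g n = 0" unfolding const by (simp add: LIMSEQ_const_iff)
    then show ?thesis by (simp add: g_def)
  qed
qed

theorem theorem21:
  fixes a b :: "nat list"
  assumes "admissible a" and "admissible b"
    and "\<And>n. zeta_nn a n = zeta_nn b n"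
  shows "b = a \<or> b = dual a"
proof -
  \<comment> \<open>\<open>K\<close> bounds the entries and the length of every list with non-zero
    coefficient in \<open>a\<close> or \<open>b\<close>; the summand 1 keeps it positive.\<close>
  define K where "K = sum_list a + sum_list b + 1"
  define p where "p J = [:real (coefficient a J) - real (coefficient b J):]" for J
  have "(\<Sum>J\<in>bounded_lists K K. poly (p J) (real n) * nested J n) = 0" if "n \<ge> 1" for n
    using assms(3)[of n] zeta_nn_eq_sum_nested[OF assms(1), of K K n]
      zeta_nn_eq_sum_nested[OF assms(2), of K K n] that
    by (simp add: p_def K_def left_diff_distrib sum_subtractf del: nested.simps)
  moreover have "p J = 0" if "J \<noteq> []" "last J < 2" for J
    using coefficient_last_ge_2[OF assms(1), of J] coefficient_last_ge_2[OF assms(2), of J] that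
    by (force simp: p_def)
  moreover have "K \<ge> 1" by (simp add: K_def)
  ultimately have inside: "p J = 0" if "J \<in> bounded_lists K K" for J
    using nested_independent that by blast
  \<comment> \<open>Independence covers only bounded lists; outside them both coefficients vanish by
    weight.\<close>
  have "coefficient c J = 0" if "admissible c" "sum_list c \<le> K" "J \<notin> bounded_lists K K" for c J
  proof (rule ccontr)
    assume nz: "coefficient c J \<noteq> 0"
    have s: "sum_list J \<le> K" and J0: "0 \<notin> set J"
      using coefficient_sum_list[OF that(1) nz] coefficient_pos_parts[OF that(1) nz] that(2) by auto
    have "j \<le> K" if "j \<in> set J" for j using member_le_sum_list[OF that] s by linarith
    moreover have "length J \<le> sum_list J"
      using J0 by (induction J) auto
    moreover have "1 \<le> j" if "j \<in> set J" for j using that J0 by (cases "j = 0") auto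
    ultimately have "set J \<subseteq> {1..K}" "length J \<le> K" using s by auto
    then show False using that(3) by (simp add: bounded_lists_def)
  qed
  from this[OF assms(1)] this[OF assms(2)] have "coefficient a J = coefficient b J" for J
    using inside[of J] by (cases "J \<in> bounded_lists K K") (auto simp: p_def K_def)
  then have "coefficient a = coefficient b" by blast
  then show ?thesis
    using coefficient_determines_word eq_or_dual_of_word_eq assms(1,2) by blast
qed

end
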